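(* Let $1<\alpha\leq 2$ and let $X=(X_t)_{t\geq0}$ be a scalar symmetric $\alpha$-stable Lévy process with $X_0=0$ and $\mathbb{E}[e^{iuX_t}]=e^{-|u|^{\alpha}t}$; let $L_T(y)$, $y\in\mathbb{R}$, denote its local time up to time $T>0$. Let $\Delta_n=T/n$, $t_k=k\Delta_n$, let $h_n>0$ and \[ \hat L_{T,n}(y)=\frac{\Delta_n}{2h_n}\sum_{k=1}^n\mathbf{1}_{[y-h_n,y+h_n]}(X_{t_{k-1}}). \] Let $y\in\mathbb{R}$. Then for any sufficiently small $\varepsilon>0$ there is $C<\infty$, independent of $T$ and $n$, such that \[ \bigl\|\hat L_{T,n}(y)-L_T(y)\bigr\|^2_{L^2(\mathbb{P})}\leq C(1\vee T^{-\varepsilon})T^{1-1/\alpha}\bigl(h_n^{\alpha-1}+\Delta_n^{1+1/\alpha}h_n^{-2}\bigr). \] In particular, if $h_n=\Delta_n^{1/\alpha}$, then $\Delta_n^{1/\alpha-1}\|\hat L_{T,n}(y)-L_T(y)\|^2_{L^2(\mathbb{P})}\leq C(1\vee T^{-\varepsilon})T^{1-1/\alpha}$.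
   Context: For $1<\alpha\leq2$ the local time $L_T(y)$ is the density with respect to Lebesgue measure of the occupation measure $A\mapsto\int_0^T\mathbf{1}_A(X_t)dt$, so that $\int_0^T f(X_s)ds=\int_{\mathbb{R}}f(x)L_T(x)dx$ for all nonnegative measurable $f$. *)

theory Defs
  imports "HOL-Probability.Probability"
begin

text \<open>Scalar symmetric alpha-stable Levy process started at 0, with
  E[exp(i u X_t)] = exp(-|u|^alpha t): X_0 = 0, cadlag paths, independent
  increments, and every increment X_t - X_s (0 <= s <= t) has characteristic
  function exp(-|u|^alpha (t - s)) (this encodes stationarity of increments and
  the law of X_t).\<close>
definition sym_stable_levy :: "'a measure \<Rightarrow> real \<Rightarrow> (real \<Rightarrow> 'a \<Rightarrow> real) \<Rightarrow> bool" where
  "sym_stable_levy M \<alpha> X \<longleftrightarrow>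
     prob_space M \<and>
     (\<forall>t. X t \<in> borel_measurable M) \<and>
     (\<forall>\<omega>\<in>space M. X 0 \<omega> = 0) \<and>
     (\<forall>\<omega>\<in>space M. \<forall>t\<ge>0. continuous (at_right t) (\<lambda>s. X s \<omega>)) \<and>
     (\<forall>\<omega>\<in>space M. \<forall>t>0. \<exists>l. ((\<lambda>s. X s \<omega>) \<longlongrightarrow> l) (at_left t)) \<and>
     (\<forall>(t::nat \<Rightarrow> real) m. 0 \<le> t 0 \<longrightarrow> mono t \<longrightarrow>
        prob_space.indep_vars M (\<lambda>_. borel) (\<lambda>i \<omega>. X (t (Suc i)) \<omega> - X (t i) \<omega>) {..<m}) \<and>
     (\<forall>s t u. 0 \<le> s \<longrightarrow> s \<le> t \<longrightarrow>
        char (distr M borel (\<lambda>\<omega>. X t \<omega> - X s \<omega>)) u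
          = complex_of_real (exp (- (\<bar>u\<bar> powr \<alpha>) * (t - s))))"

text \<open>L T y \<omega> is the local time of X up to time T at level y: almost surely,
  for every T > 0, y \<mapsto> L T y \<omega> is continuous (the canonical version, so that
  the value at a fixed level is well defined) and is the density of the
  occupation measure A \<mapsto> \<integral>_0^T 1_A(X_s) ds, i.e. the occupation density formula
  holds for every nonnegative Borel f.\<close>
definition is_local_time :: "'a measure \<Rightarrow> (real \<Rightarrow> 'a \<Rightarrow> real) \<Rightarrow> (real \<Rightarrow> real \<Rightarrow> 'a \<Rightarrow> real) \<Rightarrow> bool" where
  "is_local_time M X L \<longleftrightarrow>
     (\<forall>T y. L T y \<in> borel_measurable M) \<and>
     (AE \<omega> in M. \<forall>T>0.
        continuous_on UNIV (\<lambda>y. L T y \<omega>) \<and>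
        (\<forall>y. 0 \<le> L T y \<omega>) \<and>
        (\<forall>f :: real \<Rightarrow> ennreal. f \<in> borel_measurable borel \<longrightarrow>
           (\<integral>\<^sup>+ s. f (X s \<omega>) * indicator {0..T} s \<partial>lborel)
             = (\<integral>\<^sup>+ x. f x * ennreal (L T x \<omega>) \<partial>lborel)))"

definition local_time_est :: "(real \<Rightarrow> 'a \<Rightarrow> real) \<Rightarrow> real \<Rightarrow> nat \<Rightarrow> real \<Rightarrow> real \<Rightarrow> 'a \<Rightarrow> real" where
  "local_time_est X T n h y \<omega> =
     (T / real n) / (2 * h) *
     (\<Sum>k=1..n. indicator {y - h .. y + h} (X (real (k - 1) * (T / real n)) \<omega>))"

end

theory Submission
  imports Defs
begin

text \<open>
  By Fourier inversion, the average over [c - h, c + h] of the law of an increment over a time r is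
  the integral of exp(-iuc) sinc(uh) exp(-|u|^\<alpha> r) / (2 pi). Three bounds follow, up to
  constants: the average itself is at most r^(-1/\<alpha>), passing from r to r' > r changes it by at
  most r^(-1/\<alpha>) - r'^(-1/\<alpha>), and replacing h by a smaller width changes it by at most
  h^2 r^(-3/\<alpha>). With independence of increments they bound E[Y_s Y_t] by m(s) w(t - s) for
  each of the two error processes below, hence the second moment of the time integral of Y by
  twice the product of the integrals of m and w.

  Let A_h be the time integral over [0, T] of the normalised indicator of [y - h, y + h] along the
  path. Continuity of the local time gives L_T(y) = lim A_d as d tends to 0, so by Fatou's lemma it
  suffices to bound the estimator minus A_d uniformly in d. The part A_h - A_d is of order
  T^(1 - 1/\<alpha>) h^(\<alpha> - 1). The discretisation error minus the contribution of the
  first grid cell is of order T^(1 - 1/\<alpha>) (\<Delta> / h + \<Delta>^(1 - 1/\<alpha>)), which the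
  asserted rate dominates; the first cell is at most \<Delta> / (2h) pathwise. No loss in
  \<epsilon> is incurred, so the factor max 1 (T^(-\<epsilon>)) is simply bounded below by 1.
\<close>

section \<open>Fourier inversion for integrable characteristic functions\<close>

text \<open>Cancellation is sought only in the later factor of \<open>Y s * Y t\<close>. Given the
  position at an earlier time, the conditional mean of that factor is a difference of interval
  averages of increment laws, bounded uniformly in the position; the earlier factor enters only
  through means of nonnegative windows. This is where the product form m(s) w(t - s) comes from.

  The lag part w is integrable over all positive lags, so T enters through the marginal part alone
  and gives exactly T^(1 - 1/\<alpha>). Integrability near lag 0 rests on 1/\<alpha> < 1 or on a
  truncation; at infinity it comes from the cancellation, which improves r^(-1/\<alpha>) to
  r^(-3/\<alpha>) for a change of width and to r^(-1/\<alpha> - 1) for a change of time.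

  The first grid cell is separated because its grid time is 0, where the law of X is a point mass
  and the marginal bound r^(-1/\<alpha>) says nothing. On every later cell the grid time is at least
  s / 2.\<close>

definition stable_moment :: "real \<Rightarrow> nat \<Rightarrow> real" where
  "stable_moment \<alpha> k = (LBINT u. \<bar>u\<bar> ^ k * exp (- (\<bar>u\<bar> powr \<alpha>)))"

lemma integrable_abs_power_exp: "integrable lborel (\<lambda>u::real. \<bar>u\<bar> ^ k * exp (- \<bar>u\<bar>))"
proof -
  let ?f = "\<lambda>x::real. x ^ k * exp (- x) * indicator {0..} x"
  have f: "integrable lborel ?f"
    using has_bochner_integral_I0i_power_exp_m'[of k] by (simp add: has_bochner_integral_iff)
  have "integrable lborel (\<lambda>x. ?f (0 + (-1) * x))"
    using lborel_integrable_real_affine[OF f, of "-1" 0] by simp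
  with f have "integrable lborel (\<lambda>x. ?f x + ?f (0 + (-1) * x))"
    by (rule Bochner_Integration.integrable_add)
  \<comment> \<open>Domination rather than equality: for \<open>k = 0\<close> both halves contribute
    at the origin, where the sum is twice the integrand.\<close>
  then show ?thesis
    by (rule Bochner_Integration.integrable_bound) (auto simp: indicator_def)
qed

text \<open>Since |u| - 1 \<le> |u|^\<alpha> for \<alpha> \<ge> 1, the integrand is at most e times
  its exponential counterpart.\<close>

lemma integrable_stable_moment:
  assumes "1 \<le> \<alpha>"
  shows "integrable lborel (\<lambda>u::real. \<bar>u\<bar> ^ k * exp (- (\<bar>u\<bar> powr \<alpha>)))"
proof -
  have le: "\<bar>u\<bar> - 1 \<le> \<bar>u\<bar> powr \<alpha>" for u :: real
  proof (cases "1 \<le> \<bar>u\<bar>")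
    case True
    then have "\<bar>u\<bar> powr 1 \<le> \<bar>u\<bar> powr \<alpha>" using assms by (intro powr_mono) auto
    then show ?thesis using True by simp
  next
    case False
    moreover have "0 \<le> \<bar>u\<bar> powr \<alpha>" by simp
    ultimately show ?thesis by linarith
  qed
  have "exp (- (\<bar>u\<bar> powr \<alpha>)) \<le> exp 1 * exp (- \<bar>u\<bar>)" for u :: real
    using le[of u] by (simp flip: exp_add)
  then have "\<bar>u\<bar> ^ k * exp (- (\<bar>u\<bar> powr \<alpha>)) \<le> exp 1 * (\<bar>u\<bar> ^ k * exp (- \<bar>u\<bar>))" for u :: real
    using mult_left_mono[of "exp (- (\<bar>u\<bar> powr \<alpha>))" "exp 1 * exp (- \<bar>u\<bar>)" "\<bar>u\<bar> ^ k"]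
    by (simp add: mult_ac)
  then show ?thesis
    by (intro Bochner_Integration.integrable_bound[OF integrable_mult_right[OF integrable_abs_power_exp[of k], of "exp 1"]])
      (auto simp: abs_mult)
qed

lemma stable_moment_nonneg: "0 \<le> stable_moment \<alpha> k"
  unfolding stable_moment_def by (intro integral_nonneg_AE) auto

text \<open>The substitution u = r^(-1/\<alpha>) v, which expresses the self-similarity of the
  stable law, turns the time-r integrand into the time-1 integrand; every power of r in the later
  estimates originates here.\<close>

lemma stable_moment_scaled:
  assumes "1 \<le> \<alpha>" "0 < r"
  shows "has_bochner_integral lborel (\<lambda>u. \<bar>u\<bar> ^ k * exp (- (\<bar>u\<bar> powr \<alpha>) * r))
           (stable_moment \<alpha> k * r powr (- ((real k + 1) / \<alpha>)))"
proof -
  let ?c = "r powr (- (1 / \<alpha>))"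
  let ?f = "\<lambda>u::real. \<bar>u\<bar> ^ k * exp (- (\<bar>u\<bar> powr \<alpha>) * r)"
  have c: "0 < ?c" using assms by simp
  have ca: "?c powr \<alpha> * r = 1"
  proof -
    have "?c powr \<alpha> = r powr (- 1)" using assms by (simp only: powr_powr) simp
    then show ?thesis using assms by (simp add: powr_minus)
  qed
  have eq: "?f (0 + ?c * v) = ?c ^ k * (\<bar>v\<bar> ^ k * exp (- (\<bar>v\<bar> powr \<alpha>)))" for v
  proof -
    have "\<bar>?c * v\<bar> powr \<alpha> * r = \<bar>v\<bar> powr \<alpha> * (?c powr \<alpha> * r)"
      by (simp add: abs_mult powr_mult mult_ac)
    then show ?thesis using ca by (simp add: abs_mult power_mult_distrib)
  qed
  have "integrable lborel (\<lambda>v. ?f (0 + ?c * v))"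
    unfolding eq using integrable_stable_moment[OF assms(1)] by simp
  then have int: "integrable lborel ?f"
    using lborel_integrable_real_affine_iff[of ?c ?f 0] c by simp
  have "(LBINT u. ?f u) = \<bar>?c\<bar> *\<^sub>R (LBINT v. ?f (0 + ?c * v))"
    using lborel_integral_real_affine[of ?c ?f 0] c by simp
  also have "\<dots> = ?c ^ (Suc k) * stable_moment \<alpha> k"
    unfolding eq stable_moment_def by simp
  also have "?c ^ (Suc k) = r powr (- ((real k + 1) / \<alpha>))"
    using c by (simp add: powr_realpow[symmetric] powr_powr field_simps del: power_Suc)
  finally show ?thesis using int by (simp add: has_bochner_integral_iff mult_ac)
qed

text \<open>The library's sinc is an abbreviation for a conditional, which the simplifier would keep splitting.\<close>
definition ksinc :: "real \<Rightarrow> real" where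
  "ksinc x = (if x = 0 then 1 else sin x / x)"

lemma borel_measurable_ksinc [measurable]: "ksinc \<in> borel_measurable borel"
  unfolding ksinc_def[abs_def] by (rule borel_measurable_sinc)

text \<open>Rewrites the kernel of the Levy inversion formula on a centred interval as 2h times a
  phase times a bounded real kernel. The excluded point t = 0 is a null set.\<close>

lemma iexp_diff_eq_ksinc:
  assumes "t \<noteq> 0"
  shows "(iexp (- (t * (c - h))) - iexp (- (t * (c + h)))) / (\<i> * t) = 2 * h * (iexp (- (t * c)) * ksinc (t * h))"
proof -
  have *: "- (t * (c - h)) = - (t * c) + t * h" "- (t * (c + h)) = - (t * c) - t * h"
    by (simp_all add: algebra_simps)
  have "iexp (- (t * (c - h))) - iexp (- (t * (c + h))) = 2 * \<i> * (iexp (- (t * c)) * sin (t * h))"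
    unfolding * by (simp add: complex_eq_iff Re_exp Im_exp sin_add cos_add sin_diff cos_diff)
  then show ?thesis using assms by (simp add: ksinc_def field_simps)
qed

lemma abs_ksinc_le_1: "\<bar>ksinc x\<bar> \<le> 1"
  using abs_sin_x_le_abs_x[of x] by (auto simp: ksinc_def divide_simps)

text \<open>The second-order Taylor polynomial of exp(ix) has imaginary part x, so the third-order
  remainder bounds sin x - x; dividing by x leaves a quadratic bound, with the constant 1/6 rounded
  up to 1.\<close>

lemma abs_ksinc_minus_1_le: "\<bar>ksinc x - 1\<bar> \<le> x\<^sup>2"
proof (cases "x = 0")
  case False
  have "\<bar>sin x - x\<bar> \<le> \<bar>x\<bar> ^ 3"
  proof -
    have "cmod (iexp x - (\<Sum>k\<le>2. (\<i> * x) ^ k / fact k)) \<le> \<bar>x\<bar> ^ 3 / fact 3"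
      using iexp_approx1[of x 2] by (simp add: eval_nat_numeral)
    then have "\<bar>Im (iexp x - (\<Sum>k\<le>2. (\<i> * x) ^ k / fact k))\<bar> \<le> \<bar>x\<bar> ^ 3 / fact 3"
      using abs_Im_le_cmod order_trans by blast
    moreover have "Im (iexp x - (\<Sum>k\<le>2. (\<i> * x) ^ k / fact k)) = sin x - x"
      by (simp add: eval_nat_numeral Im_exp power2_eq_square)
    moreover have "0 \<le> \<bar>x\<bar> ^ 3" by simp
    then have "\<bar>x\<bar> ^ 3 / fact 3 \<le> \<bar>x\<bar> ^ 3" by (simp add: fact_numeral del: zero_le_power_abs)
    ultimately show ?thesis by linarith
  qed
  also have "\<dots> = x\<^sup>2 * \<bar>x\<bar>"
    by (metis power2_abs power3_eq_cube power2_eq_square)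
  finally have "\<bar>sin x - x\<bar> / \<bar>x\<bar> \<le> x\<^sup>2" using False by (subst pos_divide_le_eq) auto
  then have "\<bar>(sin x - x) / x\<bar> \<le> x\<^sup>2" by simp
  moreover have "(sin x - x) / x = ksinc x - 1" using False by (simp add: ksinc_def diff_divide_distrib)
  ultimately show ?thesis by simp
qed (simp add: ksinc_def)

text \<open>Levy's formula gives a limit of integrals over (-n, n). As the kernel has modulus at
  most 1, the characteristic function dominates the integrands and the limit is the integral over
  the whole line.\<close>

lemma (in real_distribution) Levy_inversion_integrable:
  assumes int: "integrable lborel (char M)" and "0 < h"
    and "measure M {c - h} = 0" "measure M {c + h} = 0"
  shows "of_real (measure M {c - h<..c + h} / (2 * h)) =
    1 / (2 * pi) * (CLINT u|lborel. iexp (- (u * c)) * ksinc (u * h) * char M u)"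
proof -
  let ?g = "\<lambda>u. iexp (- (u * c)) * ksinc (u * h) * char M u"
  let ?F = "\<lambda>t. (iexp (- (t * (c - h))) - iexp (- (t * (c + h)))) / (\<i> * t) * char M t"
  have mg: "?g \<in> borel_measurable borel" by measurable
  have norm_g: "cmod (?g u) \<le> cmod (char M u)" for u
    using mult_right_mono[OF abs_ksinc_le_1[of "u * h"], of "cmod (char M u)"]
    by (simp add: norm_mult del: of_real_mult)
  have eq: "(CLBINT t=-T..T. ?F t) = 2 * h * (CLINT u|lborel. indicator {-T<..<T} u *\<^sub>R ?g u)" if "0 \<le> T" for T :: real
  proof -
    have "(CLBINT t=-T..T. ?F t) = (CLINT t|lborel. indicator {-T<..<T} t *\<^sub>R ?F t)"
      using that by (simp add: interval_lebesgue_integral_def set_lebesgue_integral_def)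
    also have "\<dots> = (CLINT t|lborel. 2 * h * (indicator {-T<..<T} t *\<^sub>R ?g t))"
    proof (intro integral_cong_AE)
      have "AE t in lborel. t \<noteq> (0::real)" by (rule AE_lborel_singleton)
      then show "AE t in lborel. indicator {-T<..<T} t *\<^sub>R ?F t = 2 * h * (indicator {-T<..<T} t *\<^sub>R ?g t)"
        by eventually_elim (subst iexp_diff_eq_ksinc, assumption, simp add: mult_ac)
    qed measurable
    also have "\<dots> = 2 * h * (CLINT t|lborel. indicator {-T<..<T} t *\<^sub>R ?g t)"
      by (rule integral_mult_right_zero)
    finally show ?thesis .
  qed
  have "(\<lambda>n::nat. 1 / (2 * pi) * (CLBINT t=-n..n. ?F t)) \<longlonglongrightarrow> measure M {c - h<..c + h}"
    using Levy_Inversion[of "c - h" "c + h"] assms by simp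
  then have 1: "(\<lambda>n::nat. 1 / (2 * pi) * (2 * h * (CLINT u|lborel. indicator {-real n<..<real n} u *\<^sub>R ?g u)))
      \<longlonglongrightarrow> measure M {c - h<..c + h}"
    using eq[OF of_nat_0_le_iff] by (simp only: of_int_minus of_int_of_nat_eq)
  have "(\<lambda>n::nat. (CLINT u|lborel. indicator {-real n<..<real n} u *\<^sub>R ?g u)) \<longlonglongrightarrow> (CLINT u|lborel. ?g u)"
  proof (rule integral_dominated_convergence[where w="\<lambda>u. cmod (char M u)"])
    show "integrable lborel (\<lambda>u. cmod (char M u))" using int by simp
    show "AE u in lborel. (\<lambda>n::nat. indicator {-real n<..<real n} u *\<^sub>R ?g u) \<longlonglongrightarrow> ?g u"
    proof (rule AE_I2)
      fix u :: real
      obtain N :: nat where N: "\<bar>u\<bar> < N" using reals_Archimedean2 by blast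
      have "\<forall>\<^sub>F n::nat in sequentially. indicator {-real n<..<real n} u *\<^sub>R ?g u = ?g u"
        using eventually_ge_at_top[of N] by eventually_elim (use N in \<open>auto simp: indicator_def\<close>)
      then show "(\<lambda>n::nat. indicator {-real n<..<real n} u *\<^sub>R ?g u) \<longlonglongrightarrow> ?g u"
        by (rule tendsto_eventually)
    qed
    show "AE u in lborel. cmod (indicator {-real n<..<real n} u *\<^sub>R ?g u) \<le> cmod (char M u)" for n :: nat
      using norm_g by (auto simp: indicator_def simp del: norm_mult)
  qed (use mg in measurable)
  then have "(\<lambda>n::nat. 1 / (2 * pi) * (2 * h * (CLINT u|lborel. indicator {-real n<..<real n} u *\<^sub>R ?g u)))
      \<longlonglongrightarrow> 1 / (2 * pi) * (2 * h * (CLINT u|lborel. ?g u))"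
    by (intro tendsto_intros)
  with 1 have "complex_of_real (measure M {c - h<..c + h}) = 1 / (2 * pi) * (2 * h * (CLINT u|lborel. ?g u))"
    using LIMSEQ_unique by blast
  then show ?thesis using \<open>0 < h\<close> by simp
qed

lemma (in real_distribution) integrable_Levy_integrand:
  assumes "integrable lborel (char M)"
  shows "integrable lborel (\<lambda>u. iexp (- (u * c)) * ksinc (u * h) * char M u)"
proof (rule Bochner_Integration.integrable_bound[OF assms])
  show "AE u in lborel. cmod (iexp (- (u * c)) * ksinc (u * h) * char M u) \<le> cmod (char M u)"
    using mult_right_mono[OF abs_ksinc_le_1] by (auto simp: norm_mult)
qed measurable

text \<open>Inversion bounds the mass of (a, b] by a multiple of b - a as soon as a and b are not
  atoms. Atoms are countable, so such endpoints exist arbitrarily close to x on both sides. This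
  frees the inversion formula from its conditions on endpoints.\<close>

lemma (in real_distribution) no_atom_of_integrable_char:
  assumes int: "integrable lborel (char M)"
  shows "measure M {x} = 0"
proof -
  define K where "K = 1 / (2 * pi) * (LINT u|lborel. cmod (char M u))"
  have K: "measure M {a<..b} \<le> K * (b - a)" if "a < b" "measure M {a} = 0" "measure M {b} = 0" for a b
  proof -
    define c h where "c = (a + b) / 2" and "h = (b - a) / 2"
    have ab: "a = c - h" "b = c + h" "0 < h" using that by (auto simp: c_def h_def field_simps)
    have "measure M {a<..b} / (2 * h) = cmod (of_real (measure M {a<..b} / (2 * h)))"
      using \<open>0 < h\<close> by (simp add: norm_divide)
    also have "\<dots> = 1 / (2 * pi) * cmod (CLINT u|lborel. iexp (- (u * c)) * ksinc (u * h) * char M u)"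
      using that unfolding ab by (subst Levy_inversion_integrable[OF int ab(3)]) (simp_all add: norm_mult norm_divide)
    also have "\<dots> \<le> K"
      unfolding K_def
    proof (intro mult_left_mono)
      show "cmod (CLINT u|lborel. iexp (- (u * c)) * ksinc (u * h) * char M u) \<le> (LINT u|lborel. cmod (char M u))"
      proof (rule order_trans[OF integral_norm_bound integral_mono])
        show "cmod (iexp (- (u * c)) * ksinc (u * h) * char M u) \<le> cmod (char M u)" for u
          using mult_right_mono[OF abs_ksinc_le_1] by (auto simp: norm_mult)
      qed (use int integrable_Levy_integrand[OF int] in auto)
    qed simp
    finally show ?thesis using \<open>0 < h\<close> by (simp add: ab field_simps)
  qed
  have K0: "0 \<le> K" unfolding K_def by (intro mult_nonneg_nonneg integral_nonneg_AE) auto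
  have "measure M {x} \<le> e" if "0 < e" for e :: real
  proof -
    \<comment> \<open>Dividing by \<open>K + 1\<close> instead of \<open>K\<close> covers the case
      \<open>K = 0\<close>.\<close>
    define d where "d = e / (2 * (K + 1))"
    have d: "0 < d" "K * (2 * d) \<le> e" using that K0 by (auto simp: d_def field_simps)
    obtain a where a: "a \<in> {x - d<..<x}" "a \<notin> {x. measure M {x} \<noteq> 0}"
      using open_minus_countable[OF countable_support, of "{x - d<..<x}"] d by auto
    obtain b where b: "b \<in> {x<..<x + d}" "b \<notin> {x. measure M {x} \<noteq> 0}"
      using open_minus_countable[OF countable_support, of "{x<..<x + d}"] d by auto
    have "measure M {x} \<le> measure M {a<..b}"
      using a b by (intro finite_measure_mono) auto
    also have "\<dots> \<le> K * (b - a)" using a b by (intro K) auto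
    also have "\<dots> \<le> K * (2 * d)" using a b K0 by (intro mult_left_mono) auto
    finally show ?thesis using d by linarith
  qed
  then have "measure M {x} \<le> 0" by (rule field_le_epsilon[where y=0, simplified])
  then show ?thesis using measure_nonneg[of M "{x}"] by linarith
qed

lemma (in real_distribution) Levy_inversion_closed:
  assumes int: "integrable lborel (char M)" and "0 < h"
  shows "of_real (measure M {c - h..c + h} / (2 * h)) =
    1 / (2 * pi) * (CLINT u|lborel. iexp (- (u * c)) * ksinc (u * h) * char M u)"
proof -
  have "{c - h..c + h} = {c - h} \<union> {c - h<..c + h}" using \<open>0 < h\<close> by auto
  then have "measure M {c - h..c + h} = measure M {c - h} + measure M {c - h<..c + h}"
    by (simp only:, subst finite_measure_Union) auto
  then show ?thesis
    using Levy_inversion_integrable[OF int \<open>0 < h\<close>] no_atom_of_integrable_char[OF int] by simp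
qed

section \<open>Symmetric stable laws\<close>

text \<open>The two moments that the proof uses. Divided by 2 pi, they are the density of the law at
  0 and a bound for the second derivative of that density, both at time r.\<close>

lemma stable_moment_scaled_0_2:
  assumes "1 \<le> \<alpha>" "0 < r"
  shows "integrable lborel (\<lambda>u. exp (- (\<bar>u\<bar> powr \<alpha>) * r))" (is ?A)
    "(LBINT u. exp (- (\<bar>u\<bar> powr \<alpha>) * r)) = stable_moment \<alpha> 0 * r powr (- (1 / \<alpha>))" (is ?B)
    "integrable lborel (\<lambda>u. u\<^sup>2 * exp (- (\<bar>u\<bar> powr \<alpha>) * r))" (is ?C)
    "(LBINT u. u\<^sup>2 * exp (- (\<bar>u\<bar> powr \<alpha>) * r)) = stable_moment \<alpha> 2 * r powr (- (3 / \<alpha>))" (is ?D)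
proof -
  show ?A ?B using stable_moment_scaled[OF assms, of 0] by (simp_all add: has_bochner_integral_iff)
  show ?C ?D using stable_moment_scaled[OF assms, of 2] by (simp_all add: has_bochner_integral_iff)
qed

definition stable_law :: "real measure \<Rightarrow> real \<Rightarrow> real \<Rightarrow> bool" where
  "stable_law \<mu> \<alpha> r \<longleftrightarrow> real_distribution \<mu> \<and> (\<forall>u. char \<mu> u = of_real (exp (- (\<bar>u\<bar> powr \<alpha>) * r)))"

text \<open>The density at c of \<mu> convolved with the uniform law on [-h, h]; the factor sinc in
  the inversion formula is the transform of that uniform law.\<close>

definition interval_avg :: "real measure \<Rightarrow> real \<Rightarrow> real \<Rightarrow> real" where
  "interval_avg \<mu> h c = measure \<mu> {c - h..c + h} / (2 * h)"

lemma stable_law_integrable_char: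
  assumes "stable_law \<mu> \<alpha> r" "1 \<le> \<alpha>" "0 < r"
  shows "integrable lborel (char \<mu>)"
proof -
  have "char \<mu> = (\<lambda>u. of_real (exp (- (\<bar>u\<bar> powr \<alpha>) * r)))"
    using assms by (auto simp: stable_law_def)
  then show ?thesis using stable_moment_scaled_0_2(1)[OF assms(2,3)]
    by (simp add: integrable_of_real)
qed

text \<open>Common source of the bounds for a change of time and for a change of width. The phase
  exp(-iuc) has modulus 1, so the estimate is uniform in c, as conditioning on a random position
  requires; the prefactor 1/(2 pi) is bounded by 1.\<close>

lemma stable_law_interval_avg_diff:
  assumes \<mu>: "stable_law \<mu> \<alpha> r" and \<nu>: "stable_law \<nu> \<alpha> r'" and "1 \<le> \<alpha>" "0 < r" "0 < r'" "0 < h" "0 < h'"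
    and g: "integrable lborel g"
    and le: "\<And>u. \<bar>ksinc (u * h) * exp (- (\<bar>u\<bar> powr \<alpha>) * r) - ksinc (u * h') * exp (- (\<bar>u\<bar> powr \<alpha>) * r')\<bar> \<le> g u"
  shows "\<bar>interval_avg \<mu> h c - interval_avg \<nu> h' c\<bar> \<le> (LBINT u. g u)"
proof -
  interpret \<mu>: real_distribution \<mu> using \<mu> by (simp add: stable_law_def)
  interpret \<nu>: real_distribution \<nu> using \<nu> by (simp add: stable_law_def)
  have ch: "char \<mu> u = of_real (exp (- (\<bar>u\<bar> powr \<alpha>) * r))" "char \<nu> u = of_real (exp (- (\<bar>u\<bar> powr \<alpha>) * r'))" for u
    using \<mu> \<nu> by (auto simp: stable_law_def)
  note int = stable_law_integrable_char[OF \<mu> \<open>1 \<le> \<alpha>\<close> \<open>0 < r\<close>] stable_law_integrable_char[OF \<nu> \<open>1 \<le> \<alpha>\<close> \<open>0 < r'\<close>]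
  let ?f = "\<lambda>u. iexp (- (u * c)) * ksinc (u * h) * char \<mu> u"
  let ?f' = "\<lambda>u. iexp (- (u * c)) * ksinc (u * h') * char \<nu> u"
  have ff: "integrable lborel ?f" "integrable lborel ?f'"
    using \<mu>.integrable_Levy_integrand[OF int(1)] \<nu>.integrable_Levy_integrand[OF int(2)] by auto
  have "complex_of_real (interval_avg \<mu> h c - interval_avg \<nu> h' c)
      = 1 / (2 * pi) * (CLINT u|lborel. ?f u - ?f' u)"
    unfolding interval_avg_def of_real_diff
    unfolding \<mu>.Levy_inversion_closed[OF int(1) \<open>0 < h\<close>] \<nu>.Levy_inversion_closed[OF int(2) \<open>0 < h'\<close>]
      Bochner_Integration.integral_diff[OF ff] right_diff_distrib ..
  then have "cmod (of_real (interval_avg \<mu> h c - interval_avg \<nu> h' c))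
      = 1 / (2 * pi) * cmod (CLINT u|lborel. ?f u - ?f' u)"
    by (simp only: norm_mult) (simp add: norm_divide)
  then have "\<bar>interval_avg \<mu> h c - interval_avg \<nu> h' c\<bar> = 1 / (2 * pi) * cmod (CLINT u|lborel. ?f u - ?f' u)"
    by (simp only: norm_of_real)
  also have "\<dots> \<le> 1 * cmod (CLINT u|lborel. ?f u - ?f' u)"
    using pi_gt3 by (intro mult_right_mono) auto
  also have "\<dots> \<le> 1 * (LBINT u. g u)"
  proof (rule mult_left_mono[OF order_trans[OF integral_norm_bound integral_mono]])
    show "cmod (?f u - ?f' u) \<le> g u" for u
    proof -
      have "?f u - ?f' u = iexp (- (u * c)) *
          of_real (ksinc (u * h) * exp (- (\<bar>u\<bar> powr \<alpha>) * r) - ksinc (u * h') * exp (- (\<bar>u\<bar> powr \<alpha>) * r'))"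
        unfolding ch by (simp add: algebra_simps)
      then have "cmod (?f u - ?f' u) = \<bar>ksinc (u * h) * exp (- (\<bar>u\<bar> powr \<alpha>) * r) - ksinc (u * h') * exp (- (\<bar>u\<bar> powr \<alpha>) * r')\<bar>"
        by (simp only: norm_mult norm_exp_i_times norm_of_real mult_1)
      with le show ?thesis by simp
    qed
  qed (use ff g in auto)
  finally show ?thesis by simp
qed

lemma stable_law_interval_avg_le:
  assumes \<mu>: "stable_law \<mu> \<alpha> r" and "1 \<le> \<alpha>" "0 < r" "0 < h"
  shows "interval_avg \<mu> h c \<le> stable_moment \<alpha> 0 * r powr (- (1 / \<alpha>))"
proof -
  interpret \<mu>: real_distribution \<mu> using \<mu> by (simp add: stable_law_def)
  have ch: "char \<mu> u = of_real (exp (- (\<bar>u\<bar> powr \<alpha>) * r))" for u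
    using \<mu> by (auto simp: stable_law_def)
  note int = stable_law_integrable_char[OF \<mu> \<open>1 \<le> \<alpha>\<close> \<open>0 < r\<close>]
  let ?f = "\<lambda>u. iexp (- (u * c)) * ksinc (u * h) * char \<mu> u"
  have "interval_avg \<mu> h c = cmod (of_real (interval_avg \<mu> h c))"
    using \<open>0 < h\<close> by (simp only: norm_of_real) (simp add: interval_avg_def)
  also have "\<dots> = 1 / (2 * pi) * cmod (CLINT u|lborel. ?f u)"
    unfolding interval_avg_def \<mu>.Levy_inversion_closed[OF int(1) \<open>0 < h\<close>]
    by (simp only: norm_mult) (simp add: norm_divide)
  also have "\<dots> \<le> 1 * cmod (CLINT u|lborel. ?f u)"
    using pi_gt3 by (intro mult_right_mono) auto
  also have "\<dots> \<le> 1 * (LBINT u. exp (- (\<bar>u\<bar> powr \<alpha>) * r))"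
  proof (rule mult_left_mono[OF order_trans[OF integral_norm_bound integral_mono]])
    show "cmod (?f u) \<le> exp (- (\<bar>u\<bar> powr \<alpha>) * r)" for u
      using mult_right_mono[OF abs_ksinc_le_1[of "u * h"], of "exp (- (\<bar>u\<bar> powr \<alpha>) * r)"]
      unfolding ch by (simp add: norm_mult)
  qed (use \<mu>.integrable_Levy_integrand[OF int] stable_moment_scaled_0_2[OF \<open>1 \<le> \<alpha>\<close> \<open>0 < r\<close>] in auto)
  finally show ?thesis using stable_moment_scaled_0_2[OF \<open>1 \<le> \<alpha>\<close> \<open>0 < r\<close>] by simp
qed

text \<open>The characteristic functions decrease in time, so the difference has a sign and its
  absolute integral is exactly a difference of two moments. Keeping this difference preserves the
  decay for distant times.\<close>

lemma stable_law_interval_avg_time_diff: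
  assumes \<mu>: "stable_law \<mu> \<alpha> r" and \<nu>: "stable_law \<nu> \<alpha> r'" and "1 \<le> \<alpha>" "0 < r" "r \<le> r'" "0 < h"
  shows "\<bar>interval_avg \<mu> h c - interval_avg \<nu> h c\<bar>
    \<le> stable_moment \<alpha> 0 * (r powr (- (1 / \<alpha>)) - r' powr (- (1 / \<alpha>)))"
proof -
  have r': "0 < r'" using assms by simp
  let ?e = "\<lambda>r u. exp (- (\<bar>u\<bar> powr \<alpha>) * r)"
  have "\<bar>interval_avg \<mu> h c - interval_avg \<nu> h c\<bar> \<le> (LBINT u. ?e r u - ?e r' u)"
  proof (rule stable_law_interval_avg_diff[OF \<mu> \<nu>])
    show "\<bar>ksinc (u * h) * ?e r u - ksinc (u * h) * ?e r' u\<bar> \<le> ?e r u - ?e r' u" for u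
    proof -
      have "?e r' u \<le> ?e r u" using assms by (simp add: mult_left_mono)
      then have "\<bar>ksinc (u * h) * ?e r u - ksinc (u * h) * ?e r' u\<bar> = \<bar>ksinc (u * h)\<bar> * (?e r u - ?e r' u)"
        by (simp only: right_diff_distrib[symmetric] abs_mult)
      also have "\<dots> \<le> 1 * (?e r u - ?e r' u)"
        using \<open>?e r' u \<le> ?e r u\<close> by (intro mult_right_mono abs_ksinc_le_1) simp
      finally show ?thesis by simp
    qed
  qed (use assms r' stable_moment_scaled_0_2 in auto)
  also have "\<dots> = stable_moment \<alpha> 0 * (r powr (- (1 / \<alpha>)) - r' powr (- (1 / \<alpha>)))"
    using stable_moment_scaled_0_2[OF \<open>1 \<le> \<alpha>\<close> \<open>0 < r\<close>] stable_moment_scaled_0_2[OF \<open>1 \<le> \<alpha>\<close> r']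
    by (simp add: algebra_simps)
  finally show ?thesis .
qed

text \<open>Both kernels are compared with the constant 1, at a cost of (uh)^2 each; this is the
  origin of the factor 2 and of the second moment.\<close>

lemma stable_law_interval_avg_width_diff:
  assumes \<mu>: "stable_law \<mu> \<alpha> r" and "1 \<le> \<alpha>" "0 < r" "0 < h'" "h' \<le> h"
  shows "\<bar>interval_avg \<mu> h c - interval_avg \<mu> h' c\<bar>
    \<le> 2 * h\<^sup>2 * stable_moment \<alpha> 2 * r powr (- (3 / \<alpha>))"
proof -
  let ?e = "\<lambda>r u. exp (- (\<bar>u\<bar> powr \<alpha>) * r)"
  have "\<bar>interval_avg \<mu> h c - interval_avg \<mu> h' c\<bar> \<le> (LBINT u. 2 * h\<^sup>2 * (u\<^sup>2 * ?e r u))"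
  proof (rule stable_law_interval_avg_diff[OF \<mu> \<mu>])
    show "\<bar>ksinc (u * h) * ?e r u - ksinc (u * h') * ?e r u\<bar> \<le> 2 * h\<^sup>2 * (u\<^sup>2 * ?e r u)" for u
    proof -
      have "(u * h')\<^sup>2 \<le> (u * h)\<^sup>2"
        using assms by (simp add: power_mult_distrib mult_left_mono power_mono)
      then have "\<bar>ksinc (u * h) - ksinc (u * h')\<bar> \<le> 2 * (u * h)\<^sup>2"
        using abs_ksinc_minus_1_le[of "u * h"] abs_ksinc_minus_1_le[of "u * h'"] by linarith
      then have "\<bar>ksinc (u * h) - ksinc (u * h')\<bar> * ?e r u \<le> 2 * (u * h)\<^sup>2 * ?e r u"
        by (intro mult_right_mono) auto
      moreover have "\<bar>ksinc (u * h) * ?e r u - ksinc (u * h') * ?e r u\<bar> = \<bar>ksinc (u * h) - ksinc (u * h')\<bar> * ?e r u"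
        by (simp only: left_diff_distrib[symmetric] abs_mult abs_exp_cancel)
      ultimately show ?thesis by (simp add: power_mult_distrib mult_ac)
    qed
  qed (use assms stable_moment_scaled_0_2 in auto)
  also have "\<dots> = 2 * h\<^sup>2 * stable_moment \<alpha> 2 * r powr (- (3 / \<alpha>))"
    using stable_moment_scaled_0_2[OF \<open>1 \<le> \<alpha>\<close> \<open>0 < r\<close>] by simp
  finally show ?thesis .
qed

section \<open>Second moments of time integrals\<close>

text \<open>Integrating in t before s, translation invariance makes the inner integral independent
  of s. The lag runs over all positive reals, not only up to T - s.\<close>

lemma nn_integral_lag_le:
  fixes m w :: "real \<Rightarrow> ennreal"
  assumes [measurable]: "m \<in> borel_measurable borel" "w \<in> borel_measurable borel"
    and A: "(\<integral>\<^sup>+ s. m s * indicator {0<..<T} s \<partial>lborel) \<le> A"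
    and B: "(\<integral>\<^sup>+ r. w r * indicator {0<..} r \<partial>lborel) \<le> B"
  shows "(\<integral>\<^sup>+ s. \<integral>\<^sup>+ t. m s * indicator {0<..<T} s * (w (t - s) * indicator {0<..} (t - s)) \<partial>lborel \<partial>lborel) \<le> A * B"
proof -
  have tr: "(\<integral>\<^sup>+ t. w (t - s) * indicator {0<..} (t - s) \<partial>lborel) = (\<integral>\<^sup>+ r. w r * indicator {0<..} r \<partial>lborel)" for s
    by (subst nn_integral_real_affine[of _ 1 s]) auto
  have "(\<integral>\<^sup>+ s. \<integral>\<^sup>+ t. m s * indicator {0<..<T} s * (w (t - s) * indicator {0<..} (t - s)) \<partial>lborel \<partial>lborel)
      = (\<integral>\<^sup>+ s. m s * indicator {0<..<T} s * (\<integral>\<^sup>+ r. w r * indicator {0<..} r \<partial>lborel) \<partial>lborel)"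
    by (intro nn_integral_cong) (simp add: nn_integral_cmult tr)
  also have "\<dots> = (\<integral>\<^sup>+ s. m s * indicator {0<..<T} s \<partial>lborel) * (\<integral>\<^sup>+ r. w r * indicator {0<..} r \<partial>lborel)"
    by (simp add: nn_integral_multc)
  also have "\<dots> \<le> A * B" by (rule mult_mono[OF A B]) auto
  finally show ?thesis .
qed

text \<open>The covariance bound factors into a marginal part and a lag part, so that the double
  time integral decouples.\<close>
lemma (in prob_space) second_moment_time_integral_le:
  fixes Y :: "real \<Rightarrow> 'a \<Rightarrow> real" and m w :: "real \<Rightarrow> real"
  assumes Y[measurable]: "(\<lambda>(\<omega>, s). Y s \<omega>) \<in> borel_measurable (M \<Otimes>\<^sub>M borel)"
    and bd: "\<And>s \<omega>. \<bar>Y s \<omega>\<bar> \<le> b" and "0 \<le> b" "0 \<le> T"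
    and [measurable]: "m \<in> borel_measurable borel" "w \<in> borel_measurable borel"
    and cov: "\<And>s t. 0 < s \<Longrightarrow> s < t \<Longrightarrow> t < T \<Longrightarrow> \<bar>expectation (\<lambda>\<omega>. Y s \<omega> * Y t \<omega>)\<bar> \<le> m s * w (t - s)"
    and A: "(\<integral>\<^sup>+ s. ennreal (m s) * indicator {0<..<T} s \<partial>lborel) \<le> A"
    and B: "(\<integral>\<^sup>+ r. ennreal (w r) * indicator {0<..} r \<partial>lborel) \<le> B"
    and mpos: "\<And>s. 0 < s \<Longrightarrow> 0 \<le> m s"
  shows "(\<integral>\<^sup>+ \<omega>. ennreal ((LBINT s. indicator {0<..<T} s * Y s \<omega>)\<^sup>2) \<partial>M) \<le> 2 * A * B"
proof -
  interpret P: pair_sigma_finite M "lborel :: (real \<times> real) measure" ..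
  define Z where "Z \<omega> s = indicator {0<..<T} s * Y s \<omega>" for \<omega> s
  have Z[measurable]: "(\<lambda>(\<omega>, s). Z \<omega> s) \<in> borel_measurable (M \<Otimes>\<^sub>M borel)"
    unfolding Z_def by measurable
  have ZZ[measurable]: "(\<lambda>(\<omega>, p). Z \<omega> (fst p) * Z \<omega> (snd p)) \<in> borel_measurable (M \<Otimes>\<^sub>M (lborel :: (real \<times> real) measure))"
  proof -
    have [measurable]: "(\<lambda>x. Z (fst x) (fst (snd x))) \<in> borel_measurable (M \<Otimes>\<^sub>M (borel :: (real \<times> real) measure))"
      "(\<lambda>x. Z (fst x) (snd (snd x))) \<in> borel_measurable (M \<Otimes>\<^sub>M (borel :: (real \<times> real) measure))"
      using measurable_compose[OF _ Z, of "\<lambda>x. (fst x, fst (snd x))"] measurable_compose[OF _ Z, of "\<lambda>x. (fst x, snd (snd x))"]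
      by (auto simp: borel_prod[symmetric])
    show ?thesis by (simp add: split_beta' cong: measurable_cong_sets)
  qed
  have Zb: "\<bar>Z \<omega> s\<bar> \<le> b * indicator {0<..<T} s" for \<omega> s
    using bd by (auto simp: Z_def indicator_def)
  have ZZb: "\<bar>Z \<omega> s * Z \<omega> t\<bar> \<le> b\<^sup>2" for \<omega> s t
    using mult_mono[OF bd[of s \<omega>] bd[of t \<omega>]] \<open>0 \<le> b\<close> by (auto simp: Z_def indicator_def abs_mult power2_eq_square)
  have box: "emeasure lborel ({0<..<T} \<times> {0<..<T}) < \<infinity>"
    using \<open>0 \<le> T\<close> unfolding lborel_prod[symmetric] by (subst lborel.emeasure_pair_measure_Times) (auto simp: ennreal_mult_less_top)
  have intZZ: "integrable (M \<Otimes>\<^sub>M lborel) (\<lambda>(\<omega>, p). Z \<omega> (fst p) * Z \<omega> (snd p))"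
  proof (rule integrableI_bounded_set[where A="space M \<times> ({0<..<T} \<times> {0<..<T})" and B="b\<^sup>2"])
    show "space M \<times> {0<..<T} \<times> {0<..<T} \<in> sets (M \<Otimes>\<^sub>M (lborel :: (real \<times> real) measure))"
      by (intro pair_measureI) (auto simp flip: borel_prod)
    show "emeasure (M \<Otimes>\<^sub>M (lborel :: (real \<times> real) measure)) (space M \<times> {0<..<T} \<times> {0<..<T}) < \<infinity>"
      using box by (subst lborel.emeasure_pair_measure_Times) (auto simp: emeasure_space_1 simp flip: borel_prod)
    show "AE x in M \<Otimes>\<^sub>M lborel. x \<in> space M \<times> {0<..<T} \<times> {0<..<T} \<longrightarrow>
        norm (case x of (\<omega>, p) \<Rightarrow> Z \<omega> (fst p) * Z \<omega> (snd p)) \<le> b\<^sup>2"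
      using ZZb by (intro AE_I2) (auto simp only: split: prod.split, simp)
    show "AE x in M \<Otimes>\<^sub>M lborel. x \<notin> space M \<times> {0<..<T} \<times> {0<..<T} \<longrightarrow>
        (case x of (\<omega>, p) \<Rightarrow> Z \<omega> (fst p) * Z \<omega> (snd p)) = 0"
      by (intro AE_I2) (auto simp: Z_def space_pair_measure indicator_def)
  qed (use ZZ in simp)
  have sq: "(LBINT s. Z \<omega> s)\<^sup>2 = (LBINT p. Z \<omega> (fst p) * Z \<omega> (snd p))" if "\<omega> \<in> space M" for \<omega>
  proof -
    have [measurable]: "Z \<omega> \<in> borel_measurable borel"
      using measurable_compose[OF measurable_Pair1'[OF that] Z] by simp
    have "integrable (lborel \<Otimes>\<^sub>M lborel) (\<lambda>(s, t). Z \<omega> s * Z \<omega> t)"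
      unfolding lborel_prod
    proof (rule integrableI_bounded_set[OF _ _ box, where B="b\<^sup>2"])
      show "(\<lambda>(s, t). Z \<omega> s * Z \<omega> t) \<in> borel_measurable lborel"
        unfolding borel_prod[symmetric] measurable_lborel2 split_beta'
        by (intro borel_measurable_times measurable_compose[OF measurable_fst] measurable_compose[OF measurable_snd]) auto
      show "AE x in lborel. x \<in> {0<..<T} \<times> {0<..<T} \<longrightarrow> norm (case x of (s, t) \<Rightarrow> Z \<omega> s * Z \<omega> t) \<le> b\<^sup>2"
        using ZZb[of \<omega>] by (intro AE_I2) (auto simp only: real_norm_def split: prod.split)
    qed (auto simp: Z_def indicator_def simp flip: borel_prod)
    from lborel_pair.integral_fst'[OF this]
    have "(LBINT s. LBINT t. Z \<omega> s * Z \<omega> t) = (LBINT p. Z \<omega> (fst p) * Z \<omega> (snd p))"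
      by (simp add: lborel_prod split_beta')
    then show ?thesis by (simp add: power2_eq_square)
  qed
  define R where "R p = expectation (\<lambda>\<omega>. Z \<omega> (fst p) * Z \<omega> (snd p))" for p
  have int_sq: "integrable M (\<lambda>\<omega>. (LBINT s. Z \<omega> s)\<^sup>2)"
    using P.integrable_fst'[OF intZZ] sq by (subst Bochner_Integration.integrable_cong[OF refl sq]) auto
  have intR: "integrable lborel R"
    unfolding R_def using P.integrable_snd[OF intZZ] by simp
  have E: "expectation (\<lambda>\<omega>. (LBINT s. Z \<omega> s)\<^sup>2) = (LBINT p. R p)"
    unfolding R_def using P.Fubini_integral[OF intZZ] sq by (simp cong: Bochner_Integration.integral_cong)
  define V where "V s t = ennreal (m s) * indicator {0<..<T} s * (ennreal (w (t - s)) * indicator {0<..} (t - s))" for s t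
  have [measurable]: "(\<lambda>(s, t). V s t) \<in> borel_measurable (borel \<Otimes>\<^sub>M borel)"
    unfolding V_def by measurable
  have Rle: "ennreal \<bar>R (s, t)\<bar> \<le> V s t" if "s < t" for s t
  proof (cases "0 < s \<and> t < T")
    case True
    then have "R (s, t) = expectation (\<lambda>\<omega>. Y s \<omega> * Y t \<omega>)"
      using that by (simp add: R_def Z_def)
    then have "ennreal \<bar>R (s, t)\<bar> \<le> ennreal (m s * w (t - s))"
      using cov[of s t] True that by (intro ennreal_leI) auto
    also have "\<dots> = V s t" using True that mpos[of s] by (simp add: V_def ennreal_mult')
    finally show ?thesis .
  qed (use that in \<open>auto simp: R_def Z_def\<close>)
  have sym: "R (s, t) = R (t, s)" for s t by (simp add: R_def mult.commute)
  have "(\<integral>\<^sup>+ \<omega>. ennreal ((LBINT s. Z \<omega> s)\<^sup>2) \<partial>M) = ennreal (LBINT p. R p)"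
    using int_sq E by (subst nn_integral_eq_integral) auto
  also have "\<dots> \<le> (\<integral>\<^sup>+ p. ennreal \<bar>R p\<bar> \<partial>lborel)"
    using integral_norm_bound_ennreal[OF intR] by (simp add: order_trans[OF ennreal_leI[OF abs_ge_self]])
  \<comment> \<open>The covariance bound is available for s < t only. The diagonal is a null set and
    the half with t < s is reflected by the symmetry of \<open>R\<close>, hence the two copies of
    \<open>V\<close> and the final factor 2.\<close>
  also have "\<dots> \<le> (\<integral>\<^sup>+ p. V (fst p) (snd p) + V (snd p) (fst p) \<partial>lborel)"
  proof (rule nn_integral_mono_AE)
    have "AE p in lborel \<Otimes>\<^sub>M lborel. fst p \<noteq> (snd p :: real)"
    proof (rule lborel_pair.AE_pair_measure)
      show "{p \<in> space (lborel \<Otimes>\<^sub>M lborel). fst p \<noteq> (snd p :: real)} \<in> sets (lborel \<Otimes>\<^sub>M lborel)"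
        by measurable
      show "AE s in lborel. AE t in lborel. fst (s, t) \<noteq> (snd (s, t) :: real)"
        using AE_lborel_singleton by (auto simp: eq_commute)
    qed
    then have "AE p in lborel. fst p \<noteq> (snd p :: real)" by (simp only: lborel_prod)
    then show "AE p in lborel. ennreal \<bar>R p\<bar> \<le> V (fst p) (snd p) + V (snd p) (fst p)"
    proof eventually_elim
      case (elim p)
      obtain s t where p: "p = (s, t)" by (cases p)
      consider "s < t" | "t < s" using elim p by fastforce
      then show ?case
        by cases (use Rle[of s t] Rle[of t s] sym[of s t] in \<open>auto simp: p intro: add_increasing add_increasing2\<close>)
    qed
  qed
  also have "\<dots> = (\<integral>\<^sup>+ s. \<integral>\<^sup>+ t. V s t + V t s \<partial>lborel \<partial>lborel)"
    unfolding lborel_prod[symmetric] by (subst lborel.nn_integral_fst[symmetric]) auto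
  also have "\<dots> = (\<integral>\<^sup>+ s. \<integral>\<^sup>+ t. V s t \<partial>lborel \<partial>lborel) + (\<integral>\<^sup>+ s. \<integral>\<^sup>+ t. V t s \<partial>lborel \<partial>lborel)"
    by (simp add: nn_integral_add)
  also have "(\<integral>\<^sup>+ s. \<integral>\<^sup>+ t. V t s \<partial>lborel \<partial>lborel) = (\<integral>\<^sup>+ s. \<integral>\<^sup>+ t. V s t \<partial>lborel \<partial>lborel)"
    by (rule lborel_pair.Fubini') measurable
  also have "(\<integral>\<^sup>+ s. \<integral>\<^sup>+ t. V s t \<partial>lborel \<partial>lborel) \<le> A * B"
    unfolding V_def by (rule nn_integral_lag_le[OF _ _ A B]) auto
  finally show ?thesis unfolding Z_def by (auto simp: mult_2 distrib_right intro: add_mono order_trans)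
qed

section \<open>The stable process\<close>

text \<open>Each approximation samples the path at countably many times and is therefore jointly
  measurable; right continuity gives pointwise convergence as the grid is refined.\<close>

lemma right_continuous_jointly_measurable:
  fixes f :: "real \<Rightarrow> 'a \<Rightarrow> real"
  assumes [measurable]: "\<And>t. f t \<in> borel_measurable M"
    and cont: "\<And>\<omega> t. \<omega> \<in> space M \<Longrightarrow> continuous (at_right t) (\<lambda>s. f s \<omega>)"
  shows "(\<lambda>(\<omega>, s). f s \<omega>) \<in> borel_measurable (M \<Otimes>\<^sub>M borel)"
proof (rule borel_measurable_LIMSEQ_real)
  \<comment> \<open>The summand 1 puts the sampling time strictly to the right of s even when s is
    itself a grid point, as convergence within \<open>at_right\<close> demands.\<close>
  define g where "g i s = (of_int (\<lfloor>s * real (Suc i)\<rfloor> + 1) / real (Suc i))" for i s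
  show "(\<lambda>(\<omega>, s). f (g i s) \<omega>) \<in> borel_measurable (M \<Otimes>\<^sub>M borel)" for i
  proof -
    have "(\<lambda>x. f (of_int (\<lfloor>snd x * real (Suc i)\<rfloor> + 1) / real (Suc i)) (fst x)) \<in> borel_measurable (M \<Otimes>\<^sub>M borel)"
      by (rule measurable_compose_countable[where g="\<lambda>x. \<lfloor>snd x * real (Suc i)\<rfloor>" and
            f="\<lambda>k x. f (of_int (k + 1) / real (Suc i)) (fst x)"]) measurable
    then show ?thesis by (simp add: g_def split_beta')
  qed
  show "(\<lambda>i. (\<lambda>(\<omega>, s). f (g i s) \<omega>) x) \<longlonglongrightarrow> (\<lambda>(\<omega>, s). f s \<omega>) x" if "x \<in> space (M \<Otimes>\<^sub>M borel)" for x
  proof -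
    obtain \<omega> s where x: "x = (\<omega>, s)" "\<omega> \<in> space M" using \<open>x \<in> _\<close> by (auto simp: space_pair_measure)
    have g: "s < g i s" "g i s \<le> s + 1 / real (Suc i)" for i
    proof -
      have "s + 1 / real (Suc i) = (s * real (Suc i) + 1) / real (Suc i)" by (simp add: field_simps)
      moreover have "of_int (\<lfloor>s * real (Suc i)\<rfloor> + 1) \<le> s * real (Suc i) + 1" by simp
      ultimately show "g i s \<le> s + 1 / real (Suc i)"
        unfolding g_def by (simp only: divide_right_mono of_nat_0_le_iff)
      have "s * real (Suc i) < of_int (\<lfloor>s * real (Suc i)\<rfloor> + 1)" by linarith
      then show "s < g i s" unfolding g_def by (simp only: pos_less_divide_eq of_nat_0_less_iff zero_less_Suc)
    qed
    have "(\<lambda>i. g i s) \<longlonglongrightarrow> s"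
    proof (rule tendsto_sandwich[where f="\<lambda>_. s" and h="\<lambda>i. s + 1 / real (Suc i)"])
      show "(\<lambda>i. s + 1 / real (Suc i)) \<longlonglongrightarrow> s" by real_asymp
    qed (use g in \<open>auto intro!: always_eventually less_imp_le\<close>)
    then have "filterlim (\<lambda>i. g i s) (at_right s) sequentially"
      using less_imp_neq[OF g(1), symmetric] g(1) by (auto simp: filterlim_at)
    then have "(\<lambda>i. f (g i s) \<omega>) \<longlonglongrightarrow> f s \<omega>"
      using cont[OF x(2), of s] unfolding continuous_within by (rule filterlim_compose[rotated])
    then show ?thesis by (simp add: x)
  qed
qed

definition window :: "real \<Rightarrow> real \<Rightarrow> real \<Rightarrow> real" where
  "window h y x = indicator {y - h..y + h} x / (2 * h)"

lemma window_measurable [measurable]: "window h y \<in> borel_measurable borel"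
  unfolding window_def[abs_def] by measurable

lemma window_bounds: "0 < h \<Longrightarrow> 0 \<le> window h y x" "0 < h \<Longrightarrow> window h y x \<le> 1 / (2 * h)"
  by (auto simp: window_def indicator_def)

text \<open>For an increment law this is the conditional mean of a window at the later time, given
  the position x at the earlier one.\<close>

lemma (in real_distribution) integral_window:
  "(\<integral>z. window h y (x + z) \<partial>M) = interval_avg M h (y - x)"
proof -
  have "(\<lambda>z. window h y (x + z)) = (\<lambda>z. indicator {y - x - h..y - x + h} z / (2 * h))"
    by (auto simp: window_def indicator_def fun_eq_iff)
  then show ?thesis by (simp add: interval_avg_def)
qed

locale stable_process = prob_space M for M :: "'a measure" +
  fixes \<alpha> :: real and X :: "real \<Rightarrow> 'a \<Rightarrow> real"
  assumes alpha: "1 < \<alpha>" "\<alpha> \<le> 2" and levy: "sym_stable_levy M \<alpha> X"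
begin

lemma X_measurable [measurable]: "X t \<in> borel_measurable M"
  using levy by (simp add: sym_stable_levy_def)

lemma X_0: "\<omega> \<in> space M \<Longrightarrow> X 0 \<omega> = 0"
  using levy by (simp add: sym_stable_levy_def)

text \<open>\<open>sym_stable_levy\<close> asserts path regularity at nonnegative times only, so the
  path is frozen at \<open>X 0\<close> for negative times. The time change \<tau> is later
  \<open>max 0\<close> or the rounding down to the grid.\<close>

lemma X_jointly_measurable:
  assumes [measurable]: "\<tau> \<in> borel_measurable borel" and "\<And>s. 0 \<le> \<tau> s"
  shows "(\<lambda>(\<omega>, s). X (\<tau> s) \<omega>) \<in> borel_measurable (M \<Otimes>\<^sub>M borel)"
proof -
  have "(\<lambda>(\<omega>, s). X (max 0 s) \<omega>) \<in> borel_measurable (M \<Otimes>\<^sub>M borel)"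
  proof (rule right_continuous_jointly_measurable)
    fix \<omega> t assume \<omega>: "\<omega> \<in> space M"
    show "continuous (at_right t) (\<lambda>s. X (max 0 s) \<omega>)"
    proof (cases "0 \<le> t")
      case True
      then have "continuous (at_right t) (\<lambda>s. X s \<omega>)"
        using levy \<omega> by (auto simp: sym_stable_levy_def)
      moreover have "\<forall>\<^sub>F s in at_right t. X s \<omega> = X (max 0 s) \<omega>"
        using True by (auto simp: eventually_at_filter max_def)
      ultimately show ?thesis
        using True unfolding continuous_within by (auto elim: Lim_transform_eventually)
    next
      case False
      then have "\<forall>\<^sub>F s in at_right t. X 0 \<omega> = X (max 0 s) \<omega>"
        using eventually_at_right[of t 0] by (auto simp: max_def intro!: exI[of _ 0])
      then have "((\<lambda>s. X (max 0 s) \<omega>) \<longlongrightarrow> X 0 \<omega>) (at_right t)"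
        by (intro tendsto_eventually) (auto elim: eventually_mono)
      then show ?thesis using False unfolding continuous_within by (simp add: max_def)
    qed
  qed auto
  from measurable_compose[OF _ this, of "\<lambda>(\<omega>, s). (\<omega>, \<tau> s)"] assms(2) show ?thesis
    by (simp add: split_beta' max_absorb2)
qed

definition law :: "real \<Rightarrow> real \<Rightarrow> real measure" where
  "law s t = distr M borel (\<lambda>\<omega>. X t \<omega> - X s \<omega>)"

text \<open>Stationarity enters here: the characteristic function sees the two times only through t
  - s.\<close>

lemma stable_law_law: "0 \<le> s \<Longrightarrow> s \<le> t \<Longrightarrow> stable_law (law s t) \<alpha> (t - s)"
  unfolding stable_law_def law_def
  using levy by (auto simp: sym_stable_levy_def intro!: real_distribution_distr)

text \<open>Independence of increments along 0 \<le> s \<le> t; since X starts at 0, the increment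
  over [0, s] is \<open>X s\<close> itself.\<close>

lemma indep_increment:
  assumes "0 \<le> s" "s \<le> t"
  shows "indep_var borel (X s) borel (\<lambda>\<omega>. X t \<omega> - X s \<omega>)"
proof -
  \<comment> \<open>Constant from index 2 on, because the definition of the process takes monotone
    sequences on all naturals.\<close>
  define \<tau> :: "nat \<Rightarrow> real" where "\<tau> n = (if n = 0 then 0 else if n = 1 then s else t)" for n
  have "mono \<tau>" "0 \<le> \<tau> 0" using assms by (auto simp: mono_def \<tau>_def)
  moreover have "\<forall>(t::nat \<Rightarrow> real) m. 0 \<le> t 0 \<longrightarrow> mono t \<longrightarrow>
      indep_vars (\<lambda>_. borel) (\<lambda>i \<omega>. X (t (Suc i)) \<omega> - X (t i) \<omega>) {..<m}"
    using levy unfolding sym_stable_levy_def by blast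
  ultimately have "indep_vars (\<lambda>_. borel) (\<lambda>i \<omega>. X (\<tau> (Suc i)) \<omega> - X (\<tau> i) \<omega>) {..<2}"
    by blast
  then have "indep_vars (\<lambda>_. borel) (\<lambda>i \<omega>. X (\<tau> (Suc i)) \<omega> - X (\<tau> i) \<omega>) {0, 1}"
    by (rule indep_vars_subset) auto
  then have "indep_var borel ((\<lambda>f. f 0) \<circ> (\<lambda>\<omega>. restrict (\<lambda>i. X (\<tau> (Suc i)) \<omega> - X (\<tau> i) \<omega>) {0}))
      borel ((\<lambda>f. f 1) \<circ> (\<lambda>\<omega>. restrict (\<lambda>i. X (\<tau> (Suc i)) \<omega> - X (\<tau> i) \<omega>) {1}))"
    by (intro indep_var_compose[OF indep_var_restrict[where I="{0,1}"]]) auto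
  then have "indep_var borel (\<lambda>\<omega>. X s \<omega> - X 0 \<omega>) borel (\<lambda>\<omega>. X t \<omega> - X s \<omega>)"
    by (simp add: comp_def \<tau>_def)
  then show ?thesis
    unfolding indep_var_distribution_eq using X_0
    by (auto cong: distr_cong)
qed

text \<open>The Markov property at time s: the joint law of \<open>X s\<close> and the increment is
  a product, and Fubini integrates out the increment.\<close>

lemma expectation_two_times:
  fixes f g :: "real \<Rightarrow> real"
  assumes "0 \<le> s" "s \<le> t" and [measurable]: "f \<in> borel_measurable borel" "g \<in> borel_measurable borel"
    and bd: "\<And>x. \<bar>f x\<bar> \<le> bf" "\<And>x. \<bar>g x\<bar> \<le> bg"
  shows "expectation (\<lambda>\<omega>. f (X s \<omega>) * g (X t \<omega>))
    = expectation (\<lambda>\<omega>. f (X s \<omega>) * (\<integral>z. g (X s \<omega> + z) \<partial>law s t))"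
proof -
  let ?\<nu> = "distr M borel (X s)"
  interpret \<nu>: prob_space ?\<nu> by (intro prob_space_distr) simp
  interpret \<mu>: real_distribution "law s t" using stable_law_law[OF assms(1,2)] by (simp add: stable_law_def)
  interpret P: pair_prob_space ?\<nu> "law s t" ..
  have eq: "?\<nu> \<Otimes>\<^sub>M law s t = distr M (borel \<Otimes>\<^sub>M borel) (\<lambda>\<omega>. (X s \<omega>, X t \<omega> - X s \<omega>))"
    using indep_increment[OF assms(1,2)] unfolding law_def indep_var_distribution_eq by blast
  have [measurable]: "(\<lambda>(x, z). f x * g (x + z)) \<in> borel_measurable (borel \<Otimes>\<^sub>M borel)" by measurable
  have int: "integrable (?\<nu> \<Otimes>\<^sub>M law s t) (\<lambda>(x, z). f x * g (x + z))"
  proof (rule P.P.integrable_const_bound[of _ "bf * bg"])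
    show "AE p in ?\<nu> \<Otimes>\<^sub>M law s t. norm (case p of (x, z) \<Rightarrow> f x * g (x + z)) \<le> bf * bg"
      using bd by (intro AE_I2) (auto simp: abs_mult intro!: mult_mono intro: order_trans[OF abs_ge_zero bd(1)])
  qed (simp add: law_def)
  have "expectation (\<lambda>\<omega>. f (X s \<omega>) * g (X t \<omega>))
      = (\<integral>p. (case p of (x, z) \<Rightarrow> f x * g (x + z)) \<partial>distr M (borel \<Otimes>\<^sub>M borel) (\<lambda>\<omega>. (X s \<omega>, X t \<omega> - X s \<omega>)))"
    by (subst integral_distr) auto
  also have "\<dots> = (\<integral>x. \<integral>z. f x * g (x + z) \<partial>law s t \<partial>?\<nu>)"
    unfolding eq[symmetric] using P.integral_fst'[OF int] by simp
  also have "\<dots> = (\<integral>x. f x * (\<integral>z. g (x + z) \<partial>law s t) \<partial>?\<nu>)" by simp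
  also have "\<dots> = expectation (\<lambda>\<omega>. f (X s \<omega>) * (\<integral>z. g (X s \<omega> + z) \<partial>law s t))"
  proof (subst integral_distr)
    show "(\<lambda>x. f x * (\<integral>z. g (x + z) \<partial>law s t)) \<in> borel_measurable borel"
      by (intro borel_measurable_times \<mu>.borel_measurable_lebesgue_integral) (auto simp: law_def)
  qed auto
  finally show ?thesis .
qed

end

section \<open>Power integrals and two-time estimates\<close>

lemma nn_integral_powr_from_0:
  fixes a :: real
  assumes "a > -1" "0 \<le> T"
  shows "(\<integral>\<^sup>+ s. ennreal (s powr a) * indicator {0<..<T} s \<partial>lborel) \<le> ennreal (T powr (a + 1) / (a + 1))"
proof -
  have "(\<integral>\<^sup>+ s. ennreal (s powr a) * indicator {0<..<T} s \<partial>lborel) \<le> (\<integral>\<^sup>+ s. ennreal (indicator {0..T} s * s powr a) \<partial>lborel)"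
    by (intro nn_integral_mono) (auto simp: indicator_def)
  also have "\<dots> = ennreal (T powr (a + 1) / (a + 1))"
    by (rule nn_integral_has_integral_lebesgue) (use has_integral_powr_from_0[OF assms] in auto)
  finally show ?thesis .
qed

lemma nn_integral_powr_to_inf:
  fixes c e :: real
  assumes "e < -1" "0 < c"
  shows "(\<integral>\<^sup>+ s. ennreal (s powr e) * indicator {c<..} s \<partial>lborel) \<le> ennreal (- (c powr (e + 1) / (e + 1)))"
proof -
  have "(\<integral>\<^sup>+ s. ennreal (s powr e) * indicator {c<..} s \<partial>lborel) \<le> (\<integral>\<^sup>+ s. ennreal (indicator {c..} s * s powr e) \<partial>lborel)"
    by (intro nn_integral_mono) (auto simp: indicator_def)
  also have "\<dots> = ennreal (- (c powr (e + 1) / (e + 1)))"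
    by (rule nn_integral_has_integral_lebesgue) (use has_integral_powr_to_inf[OF assms] in auto)
  finally show ?thesis .
qed

text \<open>A mean value estimate with its factor b \<le> 1 dropped. For q = x / (x + d) \<le> 1 one
  has q \<le> q^b, hence 1 - q^b \<le> d / (x + d), and no derivative is taken.\<close>

lemma powr_increment_le:
  fixes x d \<rho> b :: real
  assumes "0 < \<rho>" "\<rho> \<le> x" "0 \<le> d" "0 \<le> b" "b \<le> 1"
  shows "x powr (- b) - (x + d) powr (- b) \<le> d * \<rho> powr (- b - 1)"
proof -
  have x: "0 < x" using assms by simp
  define q where "q = x / (x + d)"
  have q: "0 < q" "q \<le> 1" using x assms by (auto simp: q_def)
  have "q powr 1 \<le> q powr b" using q assms by (intro powr_mono') auto
  then have "1 - q powr b \<le> 1 - q" using q by simp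
  also have "\<dots> = d / (x + d)" using x assms by (simp add: q_def field_simps)
  also have "\<dots> \<le> d / x" using x assms by (intro divide_left_mono) auto
  finally have *: "1 - q powr b \<le> d / x" .
  have "(x + d) powr (- b) = x powr (- b) * q powr b"
    using x assms by (simp add: q_def powr_divide powr_minus field_simps)
  then have "x powr (- b) - (x + d) powr (- b) = x powr (- b) * (1 - q powr b)"
    by (simp add: algebra_simps)
  also have "\<dots> \<le> x powr (- b) * (d / x)" using * by (intro mult_left_mono) auto
  also have "\<dots> = d * x powr (- b - 1)" using x by (simp add: powr_diff)
  also have "\<dots> \<le> d * \<rho> powr (- b - 1)"
    using assms by (intro mult_left_mono powr_mono2') auto
  finally show ?thesis .
qed

lemma window_abs_le: "0 < h \<Longrightarrow> \<bar>window h y x\<bar> \<le> 1 / (2 * h)"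
  using window_bounds[of h y x] by simp

section \<open>Two-time estimates for windows along the path\<close>

context stable_process
begin

abbreviation "\<beta> \<equiv> 1 / \<alpha>"
abbreviation "K0 \<equiv> stable_moment \<alpha> 0"
abbreviation "K2 \<equiv> stable_moment \<alpha> 2"

text \<open>\<open>\<beta> < 1\<close> makes r^(-\<beta>) integrable at 0;
  \<open>1 < 3 * \<beta>\<close> and \<open>0 < \<beta>\<close> make r^(-3\<beta>) and
  r^(-\<beta>-1) integrable at infinity.\<close>

lemma beta: "0 < \<beta>" "\<beta> < 1" "1 < 3 * \<beta>"
  using alpha by auto

lemma integrable_bounded_measurable:
  "(f :: real \<Rightarrow> real) \<in> borel_measurable borel \<Longrightarrow> (\<And>x. \<bar>f x\<bar> \<le> b) \<Longrightarrow> integrable M (\<lambda>\<omega>. f (X t \<omega>))"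
  by (rule integrable_const_bound[of _ b]) auto

text \<open>The source of the marginal factor m(s): the position at time t is the increment from the
  deterministic start.\<close>

lemma expectation_window_le:
  assumes "0 < t" "0 < h"
  shows "expectation (\<lambda>\<omega>. window h y (X t \<omega>)) \<le> K0 * t powr (- \<beta>)"
proof -
  interpret \<mu>: real_distribution "law 0 t" using stable_law_law[of 0 t] assms by (simp add: stable_law_def)
  have "expectation (\<lambda>\<omega>. window h y (X t \<omega>)) = expectation (\<lambda>\<omega>. 1 * window h y (X t \<omega>))" by simp
  also have "\<dots> = expectation (\<lambda>\<omega>. 1 * (\<integral>z. window h y (X 0 \<omega> + z) \<partial>law 0 t))"
    by (rule expectation_two_times[where f="\<lambda>_. 1" and bf=1 and bg="1 / (2 * h)"])
      (use assms window_abs_le in auto)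
  also have "\<dots> = expectation (\<lambda>\<omega>. interval_avg (law 0 t) h y)"
    using X_0 \<mu>.integral_window[of h y 0] by (intro Bochner_Integration.integral_cong) auto
  also have "\<dots> = interval_avg (law 0 t) h y" by (simp add: prob_space)
  also have "\<dots> \<le> K0 * t powr (- \<beta>)"
    using stable_law_interval_avg_le[OF stable_law_law[of 0 t]] assms alpha by simp
  finally show ?thesis .
qed

text \<open>Both the function and the time may differ between the two subtracted terms, so that one
  lemma covers a change of time with fixed window and a change of window at fixed time. The bound
  \<kappa> must hold for every position x because \<open>X s\<close> is arbitrary.\<close>

lemma expectation_increment_le:
  fixes f g g' :: "real \<Rightarrow> real"
  assumes "0 \<le> s" "s \<le> t" "s \<le> t'"
    and [measurable]: "f \<in> borel_measurable borel" "g \<in> borel_measurable borel" "g' \<in> borel_measurable borel"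
    and bd: "\<And>x. \<bar>f x\<bar> \<le> b" "\<And>x. \<bar>g x\<bar> \<le> b" "\<And>x. \<bar>g' x\<bar> \<le> b"
    and \<kappa>: "\<And>x. \<bar>(\<integral>z. g (x + z) \<partial>law s t) - (\<integral>z. g' (x + z) \<partial>law s t')\<bar> \<le> \<kappa>"
  shows "\<bar>expectation (\<lambda>\<omega>. f (X s \<omega>) * (g (X t \<omega>) - g' (X t' \<omega>)))\<bar> \<le> expectation (\<lambda>\<omega>. \<bar>f (X s \<omega>)\<bar>) * \<kappa>"
proof -
  interpret \<mu>: real_distribution "law s t" using stable_law_law[of s t] assms by (simp add: stable_law_def)
  interpret \<mu>': real_distribution "law s t'" using stable_law_law[of s t'] assms by (simp add: stable_law_def)
  have b: "0 \<le> b" using order_trans[OF abs_ge_zero bd(1)[of 0]] .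
  have bd2: "\<bar>f x * g z\<bar> \<le> b * b" "\<bar>f x * g' z\<bar> \<le> b * b" for x z
    using order_trans[OF abs_ge_zero bd(1)[of x]] bd by (auto simp: abs_mult intro!: mult_mono)
  have int: "integrable M (\<lambda>\<omega>. f (X s \<omega>) * g (X t \<omega>))" "integrable M (\<lambda>\<omega>. f (X s \<omega>) * g' (X t' \<omega>))"
    using bd2 by (auto intro!: integrable_const_bound[of _ "b * b"])
  define G where "G x = (\<integral>z. g (x + z) \<partial>law s t)" for x
  define G' where "G' x = (\<integral>z. g' (x + z) \<partial>law s t')" for x
  have [measurable]: "G \<in> borel_measurable borel" "G' \<in> borel_measurable borel"
    unfolding G_def[abs_def] G'_def[abs_def]
    by (intro \<mu>.borel_measurable_lebesgue_integral \<mu>'.borel_measurable_lebesgue_integral; simp add: law_def)+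
  have Gb: "\<bar>G x\<bar> \<le> b" "\<bar>G' x\<bar> \<le> b" for x
  proof -
    have "\<bar>G x\<bar> \<le> (\<integral>z. b \<partial>law s t)" unfolding G_def
      by (intro integral_abs_bound_integral \<mu>.integrable_const_bound[of _ b]) (auto simp: bd b)
    then show "\<bar>G x\<bar> \<le> b" using \<mu>.prob_space by simp
    have "\<bar>G' x\<bar> \<le> (\<integral>z. b \<partial>law s t')" unfolding G'_def
      by (intro integral_abs_bound_integral \<mu>'.integrable_const_bound[of _ b]) (auto simp: bd b)
    then show "\<bar>G' x\<bar> \<le> b" using \<mu>'.prob_space by simp
  qed
  have bd3: "\<bar>f x * G z\<bar> \<le> b * b" "\<bar>f x * G' z\<bar> \<le> b * b" for x z
    using order_trans[OF abs_ge_zero bd(1)[of x]] bd Gb by (auto simp: abs_mult intro!: mult_mono)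
  have intG: "integrable M (\<lambda>\<omega>. f (X s \<omega>) * G (X s \<omega>))" "integrable M (\<lambda>\<omega>. f (X s \<omega>) * G' (X s \<omega>))"
    using bd3 by (auto intro!: integrable_const_bound[of _ "b * b"])
  have "expectation (\<lambda>\<omega>. f (X s \<omega>) * (g (X t \<omega>) - g' (X t' \<omega>)))
      = expectation (\<lambda>\<omega>. f (X s \<omega>) * g (X t \<omega>)) - expectation (\<lambda>\<omega>. f (X s \<omega>) * g' (X t' \<omega>))"
    using int by (simp add: right_diff_distrib)
  also have "\<dots> = expectation (\<lambda>\<omega>. f (X s \<omega>) * G (X s \<omega>)) - expectation (\<lambda>\<omega>. f (X s \<omega>) * G' (X s \<omega>))"
    unfolding G_def G'_def
    using expectation_two_times[of s t f g b b] expectation_two_times[of s t' f g' b b] assms by simp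
  also have "\<dots> = expectation (\<lambda>\<omega>. f (X s \<omega>) * (G (X s \<omega>) - G' (X s \<omega>)))"
    using intG by (simp add: right_diff_distrib)
  finally have "\<bar>expectation (\<lambda>\<omega>. f (X s \<omega>) * (g (X t \<omega>) - g' (X t' \<omega>)))\<bar>
      = \<bar>expectation (\<lambda>\<omega>. f (X s \<omega>) * (G (X s \<omega>) - G' (X s \<omega>)))\<bar>" by simp
  also have "\<dots> \<le> expectation (\<lambda>\<omega>. \<bar>f (X s \<omega>)\<bar> * \<kappa>)"
  proof (rule order_trans[OF integral_abs_bound integral_mono])
    show "integrable M (\<lambda>\<omega>. \<bar>f (X s \<omega>) * (G (X s \<omega>) - G' (X s \<omega>))\<bar>)"
      using intG by (simp add: right_diff_distrib)
    show "integrable M (\<lambda>\<omega>. \<bar>f (X s \<omega>)\<bar> * \<kappa>)"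
      using integrable_bounded_measurable[of f b s] bd by simp
    show "\<bar>f (X s \<omega>) * (G (X s \<omega>) - G' (X s \<omega>))\<bar> \<le> \<bar>f (X s \<omega>)\<bar> * \<kappa>" for \<omega>
      using \<kappa>[of "X s \<omega>"] by (auto simp: abs_mult G_def G'_def intro!: mult_left_mono)
  qed
  finally show ?thesis by simp
qed

lemma window_time_covariance:
  assumes "0 \<le> a" "a < b" "b \<le> b'" "0 < h"
  shows "\<bar>expectation (\<lambda>\<omega>. window h y (X a \<omega>) * (window h y (X b \<omega>) - window h y (X b' \<omega>)))\<bar>
    \<le> expectation (\<lambda>\<omega>. window h y (X a \<omega>)) * (K0 * ((b - a) powr (- \<beta>) - (b' - a) powr (- \<beta>)))"
proof -
  interpret \<mu>: real_distribution "law a b" using stable_law_law[of a b] assms by (simp add: stable_law_def)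
  interpret \<mu>': real_distribution "law a b'" using stable_law_law[of a b'] assms by (simp add: stable_law_def)
  have "\<bar>expectation (\<lambda>\<omega>. window h y (X a \<omega>) * (window h y (X b \<omega>) - window h y (X b' \<omega>)))\<bar>
    \<le> expectation (\<lambda>\<omega>. \<bar>window h y (X a \<omega>)\<bar>) * (K0 * ((b - a) powr (- \<beta>) - (b' - a) powr (- \<beta>)))"
  proof (rule expectation_increment_le[where b="1 / (2 * h)"])
    show "\<bar>(\<integral>z. window h y (x + z) \<partial>law a b) - (\<integral>z. window h y (x + z) \<partial>law a b')\<bar>
        \<le> K0 * ((b - a) powr (- \<beta>) - (b' - a) powr (- \<beta>))" for x
      unfolding \<mu>.integral_window \<mu>'.integral_window
      using assms alpha by (intro stable_law_interval_avg_time_diff stable_law_law) auto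
  qed (use assms window_abs_le in auto)
  then show ?thesis using window_bounds(1)[OF \<open>0 < h\<close>] by simp
qed

text \<open>The first term of the minimum ignores the cancellation and is integrable at lag 0; the
  second exploits it and is integrable at infinity. Neither involves h'.\<close>

lemma window_width_covariance:
  assumes "0 \<le> s" "s < t" "0 < h'" "h' \<le> h" and [measurable]: "f \<in> borel_measurable borel"
    and "\<And>x. \<bar>f x\<bar> \<le> b"
  shows "\<bar>expectation (\<lambda>\<omega>. f (X s \<omega>) * (window h y (X t \<omega>) - window h' y (X t \<omega>)))\<bar>
    \<le> expectation (\<lambda>\<omega>. \<bar>f (X s \<omega>)\<bar>) * min (K0 * (t - s) powr (- \<beta>)) (2 * h\<^sup>2 * K2 * (t - s) powr (- (3 * \<beta>)))"
proof -
  interpret \<mu>: real_distribution "law s t" using stable_law_law[of s t] assms by (simp add: stable_law_def)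
  have st: "stable_law (law s t) \<alpha> (t - s)" using assms by (intro stable_law_law) auto
  show ?thesis
  \<comment> \<open>A single constant has to bound \<open>f\<close> and both windows; the narrower
    window has the larger maximum.\<close>
  proof (rule expectation_increment_le[where b="max b (1 / (2 * h'))"])
    fix x
    have "\<bar>interval_avg (law s t) h c - interval_avg (law s t) h' c\<bar> \<le> K0 * (t - s) powr (- \<beta>)" for c
    proof -
      have "0 \<le> interval_avg (law s t) h c" "0 \<le> interval_avg (law s t) h' c"
        using assms by (auto simp: interval_avg_def)
      moreover have "interval_avg (law s t) h c \<le> K0 * (t - s) powr (- \<beta>)"
          "interval_avg (law s t) h' c \<le> K0 * (t - s) powr (- \<beta>)"
        using assms alpha by (auto intro!: stable_law_interval_avg_le[OF st])
      ultimately show ?thesis by linarith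
    qed
    then show "\<bar>(\<integral>z. window h y (x + z) \<partial>law s t) - (\<integral>z. window h' y (x + z) \<partial>law s t)\<bar>
        \<le> min (K0 * (t - s) powr (- \<beta>)) (2 * h\<^sup>2 * K2 * (t - s) powr (- (3 * \<beta>)))"
      unfolding \<mu>.integral_window min.bounded_iff
      using stable_law_interval_avg_width_diff[OF st, of h' h] assms alpha by simp
    show "\<bar>f x\<bar> \<le> max b (1 / (2 * h'))" using assms(6)[of x] by linarith
    show "\<bar>window h' y x\<bar> \<le> max b (1 / (2 * h'))" using window_abs_le[of h' y x] assms by linarith
    have "1 / (2 * h) \<le> 1 / (2 * h')" using assms by (simp add: frac_le)
    then show "\<bar>window h y x\<bar> \<le> max b (1 / (2 * h'))" using window_abs_le[of h y x] assms by linarith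
  qed (use assms in auto)
qed

end

section \<open>The effect of the window width\<close>

lemma two_ennreal_mult: "0 \<le> a \<Longrightarrow> 0 \<le> b \<Longrightarrow> 2 * ennreal a * ennreal b = ennreal (2 * a * b)"
  by (simp add: ennreal_mult)

context stable_process
begin

text \<open>In order: 2 for the two orderings of the times, the marginal integral with 2
  \<open>K0\<close> because two windows occur, and the lag integral.\<close>

definition width_const :: real where
  "width_const = 2 * (2 * K0 / (1 - \<beta>)) * (K0 / (1 - \<beta>) + 2 * K2 / (3 * \<beta> - 1))"

lemma width_const_nonneg: "0 \<le> width_const"
  unfolding width_const_def using beta stable_moment_nonneg by (intro mult_nonneg_nonneg add_nonneg_nonneg divide_nonneg_nonneg) auto

lemma nn_integral_min_powr_le:
  assumes "0 < h"
  shows "(\<integral>\<^sup>+ r. ennreal (min (K0 * r powr (- \<beta>)) (2 * h\<^sup>2 * K2 * r powr (- (3 * \<beta>)))) * indicator {0<..} r \<partial>lborel)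
    \<le> ennreal ((K0 / (1 - \<beta>) + 2 * K2 / (3 * \<beta> - 1)) * h powr (\<alpha> - 1))"
proof -
  \<comment> \<open>The crossover of the minimum up to constants: r^(-1/\<alpha>) = h^2
    r^(-3/\<alpha>) exactly at r = h^\<alpha>. Both pieces of the integral then scale as h^(\<alpha>
    - 1).\<close>
  define c where "c = h powr \<alpha>"
  have c: "0 < c" using assms by (simp add: c_def)
  have "(\<integral>\<^sup>+ r. ennreal (min (K0 * r powr (- \<beta>)) (2 * h\<^sup>2 * K2 * r powr (- (3 * \<beta>)))) * indicator {0<..} r \<partial>lborel)
    \<le> (\<integral>\<^sup>+ r. ennreal K0 * (ennreal (r powr (- \<beta>)) * indicator {0<..<c} r)
        + ennreal (2 * h\<^sup>2 * K2) * (ennreal (r powr (- (3 * \<beta>))) * indicator {c<..} r) \<partial>lborel)"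
  proof (rule nn_integral_mono_AE)
    have "AE r in lborel. r \<noteq> c" by (rule AE_lborel_singleton)
    then show "AE r in lborel. ennreal (min (K0 * r powr (- \<beta>)) (2 * h\<^sup>2 * K2 * r powr (- (3 * \<beta>)))) * indicator {0<..} r
      \<le> ennreal K0 * (ennreal (r powr (- \<beta>)) * indicator {0<..<c} r)
        + ennreal (2 * h\<^sup>2 * K2) * (ennreal (r powr (- (3 * \<beta>))) * indicator {c<..} r)"
    proof eventually_elim
      case (elim r)
      consider "r \<le> 0" | "0 < r" "r < c" | "c < r" using elim by linarith
      then show ?case
      proof cases
        case 2
        then have "ennreal (min (K0 * r powr (- \<beta>)) (2 * h\<^sup>2 * K2 * r powr (- (3 * \<beta>)))) \<le> ennreal (K0 * r powr (- \<beta>))"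
          by (intro ennreal_leI) simp
        also have "\<dots> = ennreal K0 * ennreal (r powr (- \<beta>))" by (rule ennreal_mult[OF stable_moment_nonneg powr_ge_zero])
        finally show ?thesis using 2 by simp
      next
        case 3
        have "0 \<le> 2 * h\<^sup>2 * K2" using stable_moment_nonneg by simp
        have "ennreal (min (K0 * r powr (- \<beta>)) (2 * h\<^sup>2 * K2 * r powr (- (3 * \<beta>)))) \<le> ennreal (2 * h\<^sup>2 * K2 * r powr (- (3 * \<beta>)))"
          by (intro ennreal_leI) simp
        also have "\<dots> = ennreal (2 * h\<^sup>2 * K2) * ennreal (r powr (- (3 * \<beta>)))" by (rule ennreal_mult[OF \<open>0 \<le> 2 * h\<^sup>2 * K2\<close> powr_ge_zero])
        finally show ?thesis using 3 c by simp
      qed simp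
    qed
  qed
  also have "\<dots> = ennreal K0 * (\<integral>\<^sup>+ r. ennreal (r powr (- \<beta>)) * indicator {0<..<c} r \<partial>lborel)
      + ennreal (2 * h\<^sup>2 * K2) * (\<integral>\<^sup>+ r. ennreal (r powr (- (3 * \<beta>))) * indicator {c<..} r \<partial>lborel)"
    by (simp add: nn_integral_add nn_integral_cmult)
  also have "\<dots> \<le> ennreal K0 * ennreal (c powr (- \<beta> + 1) / (- \<beta> + 1))
      + ennreal (2 * h\<^sup>2 * K2) * ennreal (- (c powr (- (3 * \<beta>) + 1) / (- (3 * \<beta>) + 1)))"
    using beta c by (intro add_mono mult_left_mono nn_integral_powr_from_0 nn_integral_powr_to_inf) auto
  also have "c powr (- \<beta> + 1) = h powr (\<alpha> - 1)"
    unfolding c_def powr_powr using alpha by (intro arg_cong[where f="\<lambda>x. h powr x"]) (simp add: field_simps)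
  also have "c powr (- (3 * \<beta>) + 1) = h powr (\<alpha> - 3)"
    unfolding c_def powr_powr using alpha by (intro arg_cong[where f="\<lambda>x. h powr x"]) (simp add: field_simps)
  also have "- (h powr (\<alpha> - 3) / (- (3 * \<beta>) + 1)) = h powr (\<alpha> - 3) / (3 * \<beta> - 1)"
    by (simp only: minus_divide_right) simp
  also have "ennreal K0 * ennreal (h powr (\<alpha> - 1) / (- \<beta> + 1)) + ennreal (2 * h\<^sup>2 * K2) * ennreal (h powr (\<alpha> - 3) / (3 * \<beta> - 1))
      = ennreal (K0 * (h powr (\<alpha> - 1) / (- \<beta> + 1)) + 2 * h\<^sup>2 * K2 * (h powr (\<alpha> - 3) / (3 * \<beta> - 1)))"
  proof -
    have "0 \<le> K0" "0 \<le> 2 * h\<^sup>2 * K2" "0 \<le> h powr (\<alpha> - 1) / (- \<beta> + 1)" "0 \<le> h powr (\<alpha> - 3) / (3 * \<beta> - 1)"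
      using beta stable_moment_nonneg by auto
    note nn = this
    show ?thesis
      unfolding ennreal_mult[OF nn(1,3), symmetric] ennreal_mult[OF nn(2,4), symmetric]
      by (rule ennreal_plus[symmetric]) (intro mult_nonneg_nonneg nn)+
  qed
  also have "h powr (\<alpha> - 3) = h powr (\<alpha> - 1) / h\<^sup>2"
  proof -
    have "h powr (\<alpha> - 1 - 2) = h powr (\<alpha> - 1) / h\<^sup>2" using assms by (subst powr_diff) simp
    then show ?thesis by simp
  qed
  also have "K0 * (h powr (\<alpha> - 1) / (- \<beta> + 1)) + 2 * h\<^sup>2 * K2 * (h powr (\<alpha> - 1) / h\<^sup>2 / (3 * \<beta> - 1))
      = (K0 / (1 - \<beta>) + 2 * K2 / (3 * \<beta> - 1)) * h powr (\<alpha> - 1)"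
    using assms by (simp add: distrib_right)
  finally show ?thesis .
qed

lemma nn_integral_marginal_le:
  assumes "0 \<le> k" "0 \<le> T"
  shows "(\<integral>\<^sup>+ s. ennreal (k * s powr (- \<beta>)) * indicator {0<..<T} s \<partial>lborel)
    \<le> ennreal (k / (1 - \<beta>) * T powr (1 - \<beta>))"
proof -
  have "(\<integral>\<^sup>+ s. ennreal (k * s powr (- \<beta>)) * indicator {0<..<T} s \<partial>lborel)
      = ennreal k * (\<integral>\<^sup>+ s. ennreal (s powr (- \<beta>)) * indicator {0<..<T} s \<partial>lborel)"
    using assms by (simp add: ennreal_mult mult.assoc nn_integral_cmult)
  also have "\<dots> \<le> ennreal k * ennreal (T powr (- \<beta> + 1) / (- \<beta> + 1))"
    using beta assms by (intro mult_left_mono nn_integral_powr_from_0) auto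
  also have "\<dots> = ennreal (k / (1 - \<beta>) * T powr (1 - \<beta>))"
    using assms by (subst ennreal_mult'[symmetric]) simp_all
  finally show ?thesis .
qed

text \<open>The bound is independent of h', which allows h' to tend to 0 afterwards.\<close>

lemma second_moment_width_le:
  assumes "0 < h'" "h' \<le> h" "0 < T"
  shows "(\<integral>\<^sup>+ \<omega>. ennreal ((LBINT s. indicator {0<..<T} s *
        (window h y (X (max 0 s) \<omega>) - window h' y (X (max 0 s) \<omega>)))\<^sup>2) \<partial>M)
    \<le> ennreal (width_const * T powr (1 - \<beta>) * h powr (\<alpha> - 1))"
proof -
  define f where "f x = window h y x - window h' y x" for x
  define w where "w r = min (K0 * r powr (- \<beta>)) (2 * h\<^sup>2 * K2 * r powr (- (3 * \<beta>)))" for r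
  have [measurable]: "f \<in> borel_measurable borel" unfolding f_def[abs_def] by measurable
  have [measurable]: "(\<lambda>(\<omega>, s). X (max 0 s) \<omega>) \<in> borel_measurable (M \<Otimes>\<^sub>M borel)"
    by (intro X_jointly_measurable) auto
  have h: "0 < h" using assms by simp
  \<comment> \<open>This bound explodes as h' tends to 0, but it only secures integrability and
    leaves no trace in the estimate.\<close>
  have bd: "\<bar>f x\<bar> \<le> 1 / h'" for x
  proof -
    have "1 / (2 * h) \<le> 1 / (2 * h')" using assms by (simp add: frac_le)
    then show ?thesis
      using window_abs_le[OF h, of y x] window_abs_le[OF assms(1), of y x] by (simp add: f_def)
  qed
  have f1: "expectation (\<lambda>\<omega>. \<bar>f (X s \<omega>)\<bar>) \<le> 2 * K0 * s powr (- \<beta>)" if "0 < s" for s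
  proof -
    have int: "integrable M (\<lambda>\<omega>. window h y (X s \<omega>))" "integrable M (\<lambda>\<omega>. window h' y (X s \<omega>))"
      using window_abs_le[OF h] window_abs_le[OF assms(1)]
      by (auto intro!: integrable_bounded_measurable)
    have "expectation (\<lambda>\<omega>. \<bar>f (X s \<omega>)\<bar>) \<le> expectation (\<lambda>\<omega>. window h y (X s \<omega>) + window h' y (X s \<omega>))"
    proof (rule integral_mono)
      show "\<bar>f (X s \<omega>)\<bar> \<le> window h y (X s \<omega>) + window h' y (X s \<omega>)" for \<omega>
        using window_bounds(1)[OF h, of y "X s \<omega>"] window_bounds(1)[OF assms(1), of y "X s \<omega>"]
        by (simp add: f_def abs_le_iff)
    qed (use int in \<open>auto simp: f_def\<close>)
    also have "\<dots> = expectation (\<lambda>\<omega>. window h y (X s \<omega>)) + expectation (\<lambda>\<omega>. window h' y (X s \<omega>))"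
      using int by simp
    also have "\<dots> \<le> 2 * K0 * s powr (- \<beta>)"
      using expectation_window_le[OF that h, of y] expectation_window_le[OF that assms(1), of y] by simp
    finally show ?thesis .
  qed
  have w0: "0 \<le> w r" for r using stable_moment_nonneg by (simp add: w_def)
  have "(\<integral>\<^sup>+ \<omega>. ennreal ((LBINT s. indicator {0<..<T} s * f (X (max 0 s) \<omega>))\<^sup>2) \<partial>M)
    \<le> 2 * ennreal (2 * K0 / (1 - \<beta>) * T powr (1 - \<beta>)) * ennreal ((K0 / (1 - \<beta>) + 2 * K2 / (3 * \<beta> - 1)) * h powr (\<alpha> - 1))"
  proof (rule second_moment_time_integral_le[where m="\<lambda>s. 2 * K0 * s powr (- \<beta>)" and w=w and b="1 / h'"])
    show "(\<lambda>(\<omega>, s). f (X (max 0 s) \<omega>)) \<in> borel_measurable (M \<Otimes>\<^sub>M borel)" by measurable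
    show "\<bar>expectation (\<lambda>\<omega>. f (X (max 0 s) \<omega>) * f (X (max 0 t) \<omega>))\<bar> \<le> 2 * K0 * s powr (- \<beta>) * w (t - s)"
      if "0 < s" "s < t" "t < T" for s t
    proof -
      have "\<bar>expectation (\<lambda>\<omega>. f (X s \<omega>) * (window h y (X t \<omega>) - window h' y (X t \<omega>)))\<bar>
          \<le> expectation (\<lambda>\<omega>. \<bar>f (X s \<omega>)\<bar>) * w (t - s)"
        unfolding w_def using that assms bd by (intro window_width_covariance) auto
      also have "\<dots> \<le> 2 * K0 * s powr (- \<beta>) * w (t - s)"
        using f1[OF that(1)] w0 by (intro mult_right_mono) auto
      finally show ?thesis using that by (simp add: f_def max_absorb2)
    qed
    show "(\<integral>\<^sup>+ s. ennreal (2 * K0 * s powr (- \<beta>)) * indicator {0<..<T} s \<partial>lborel) \<le> ennreal (2 * K0 / (1 - \<beta>) * T powr (1 - \<beta>))"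
      using assms stable_moment_nonneg by (intro nn_integral_marginal_le) auto
    show "(\<integral>\<^sup>+ r. ennreal (w r) * indicator {0<..} r \<partial>lborel) \<le> ennreal ((K0 / (1 - \<beta>) + 2 * K2 / (3 * \<beta> - 1)) * h powr (\<alpha> - 1))"
      unfolding w_def by (rule nn_integral_min_powr_le[OF h])
    show "w \<in> borel_measurable borel" unfolding w_def[abs_def] by measurable
  qed (use assms bd stable_moment_nonneg in auto)
  also have "\<dots> = ennreal (width_const * T powr (1 - \<beta>) * h powr (\<alpha> - 1))"
  proof -
    have nn: "0 \<le> 2 * K0 / (1 - \<beta>) * T powr (1 - \<beta>)" "0 \<le> K0 / (1 - \<beta>) + 2 * K2 / (3 * \<beta> - 1)"
      using beta stable_moment_nonneg by (auto intro!: add_nonneg_nonneg)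
    show ?thesis
      by (subst two_ennreal_mult[OF nn(1) mult_nonneg_nonneg[OF nn(2) powr_ge_zero]])
        (simp only: width_const_def times_divide_eq_left times_divide_eq_right mult_ac)
  qed
  finally show ?thesis by (simp add: f_def)
qed

end

section \<open>The effect of the time grid\<close>

text \<open>The maximum with 0 keeps the sampling time nonnegative for negative s, so that the
  process is evaluated only where its paths are controlled.\<close>

definition grid_floor :: "real \<Rightarrow> real \<Rightarrow> real" where
  "grid_floor \<Delta> s = max 0 (\<Delta> * of_int \<lfloor>s / \<Delta>\<rfloor>)"

lemma grid_floor_measurable [measurable]: "grid_floor \<Delta> \<in> borel_measurable borel"
  unfolding grid_floor_def[abs_def] by measurable

lemma grid_floor_nonneg: "0 \<le> grid_floor \<Delta> s"
  by (simp add: grid_floor_def)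

lemma grid_floor_bounds:
  assumes "0 < \<Delta>" "0 \<le> s"
  shows "grid_floor \<Delta> s \<le> s" "s - \<Delta> < grid_floor \<Delta> s" "\<Delta> \<le> s \<Longrightarrow> \<Delta> \<le> grid_floor \<Delta> s"
proof -
  have f: "of_int \<lfloor>s / \<Delta>\<rfloor> \<le> s / \<Delta>" "s / \<Delta> < of_int \<lfloor>s / \<Delta>\<rfloor> + 1" by linarith+
  have "\<Delta> * of_int \<lfloor>s / \<Delta>\<rfloor> \<le> s" using mult_left_mono[OF f(1), of \<Delta>] assms by simp
  then show "grid_floor \<Delta> s \<le> s" using assms by (simp add: grid_floor_def)
  have "s < \<Delta> * (of_int \<lfloor>s / \<Delta>\<rfloor> + 1)" using mult_strict_left_mono[OF f(2), of \<Delta>] assms by simp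
  then show "s - \<Delta> < grid_floor \<Delta> s" by (simp add: grid_floor_def distrib_left)
  assume "\<Delta> \<le> s"
  then have "1 \<le> \<lfloor>s / \<Delta>\<rfloor>" using assms by (simp add: le_floor_iff)
  then have "\<Delta> * 1 \<le> \<Delta> * of_int \<lfloor>s / \<Delta>\<rfloor>" using assms by (intro mult_left_mono) auto
  then show "\<Delta> \<le> grid_floor \<Delta> s" by (simp add: grid_floor_def)
qed

lemma time_integral_grid_floor:
  fixes G :: "real \<Rightarrow> real"
  assumes "0 < \<Delta>"
  shows "(LBINT s. indicator {0<..<real n * \<Delta>} s * G (grid_floor \<Delta> s)) = \<Delta> * (\<Sum>k<n. G (real k * \<Delta>))"
proof -
  let ?I = "\<lambda>k. {real k * \<Delta>..<real (Suc k) * \<Delta>}"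
  \<comment> \<open>\<open>G\<close> is an arbitrary function; measurability and integrability of
    the integrand come from this form as a finite step function. The half-open cells tile [0,
    n\<Delta>), which differs from the open interval by a null set.\<close>
  have eq: "indicator {0..<real n * \<Delta>} s * G (grid_floor \<Delta> s) = (\<Sum>k<n. indicator (?I k) s * G (real k * \<Delta>))" for s
  proof (induction n)
    case (Suc n)
    have "grid_floor \<Delta> s = real n * \<Delta>" if "s \<in> ?I n"
    proof -
      have "\<lfloor>s / \<Delta>\<rfloor> = int n" using that assms by (simp add: floor_eq_iff field_simps)
      then show ?thesis using assms by (simp add: grid_floor_def)
    qed
    moreover have "{0..<real (Suc n) * \<Delta>} = {0..<real n * \<Delta>} \<union> ?I n" "{0..<real n * \<Delta>} \<inter> ?I n = {}"
      using assms by (auto simp: mult_right_mono algebra_simps) (smt (verit) mult_nonneg_nonneg of_nat_0_le_iff)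
    ultimately show ?case using Suc
      by (auto simp: indicator_def)
  qed simp
  have "(LBINT s. indicator {0<..<real n * \<Delta>} s * G (grid_floor \<Delta> s)) = (LBINT s. indicator {0..<real n * \<Delta>} s * G (grid_floor \<Delta> s))"
  proof (rule integral_cong_AE)
    have *: "(\<lambda>s. indicator {0..<real n * \<Delta>} s * G (grid_floor \<Delta> s)) \<in> borel_measurable borel"
      unfolding eq by measurable
    then show "(\<lambda>s. indicator {0..<real n * \<Delta>} s * G (grid_floor \<Delta> s)) \<in> borel_measurable lborel" by simp
    have "(\<lambda>s. indicator {0<..<real n * \<Delta>} s * (indicator {0..<real n * \<Delta>} s * G (grid_floor \<Delta> s))) \<in> borel_measurable borel"
      using * by measurable
    also have "(\<lambda>s. indicator {0<..<real n * \<Delta>} s * (indicator {0..<real n * \<Delta>} s * G (grid_floor \<Delta> s)))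
        = (\<lambda>s. indicator {0<..<real n * \<Delta>} s * G (grid_floor \<Delta> s))"
      by (auto simp: indicator_def fun_eq_iff)
    finally show "(\<lambda>s. indicator {0<..<real n * \<Delta>} s * G (grid_floor \<Delta> s)) \<in> borel_measurable lborel" by simp
    have "AE s in lborel. s \<noteq> (0::real)" by (rule AE_lborel_singleton)
    then show "AE s in lborel. indicator {0<..<real n * \<Delta>} s * G (grid_floor \<Delta> s) = indicator {0..<real n * \<Delta>} s * G (grid_floor \<Delta> s)"
      by eventually_elim (auto simp: indicator_def)
  qed
  also have "\<dots> = (\<Sum>k<n. LBINT s. indicator (?I k) s * G (real k * \<Delta>))"
    unfolding eq using assms by (intro Bochner_Integration.integral_sum integrable_mult_left) (auto simp: mult_right_mono)
  also have "\<dots> = (\<Sum>k<n. \<Delta> * G (real k * \<Delta>))"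
    using assms by (intro sum.cong) (auto simp: measure_lborel_Ico mult_right_mono algebra_simps)
  finally show ?thesis by (simp add: sum_distrib_left)
qed

lemma local_time_est_eq_integral:
  assumes "0 < T" "0 < n"
  shows "local_time_est X T n h y \<omega> =
    (LBINT s. indicator {0<..<T} s * window h y (X (grid_floor (T / real n) s) \<omega>))"
proof -
  have "(LBINT s. indicator {0<..<real n * (T / real n)} s * window h y (X (grid_floor (T / real n) s) \<omega>))
      = T / real n * (\<Sum>k<n. window h y (X (real k * (T / real n)) \<omega>))"
    using assms by (intro time_integral_grid_floor[where G="\<lambda>s. window h y (X s \<omega>)"]) simp
  moreover have "(\<Sum>k<n. window h y (X (real k * (T / real n)) \<omega>))
      = (\<Sum>k=1..n. indicator {y - h .. y + h} (X (real (k - 1) * (T / real n)) \<omega>)) / (2 * h)"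
    unfolding sum_divide_distrib window_def
    by (rule sum.reindex_bij_witness[of _ "\<lambda>k. k - 1" Suc]) auto
  ultimately show ?thesis using assms by (simp add: local_time_est_def)
qed

text \<open>Both sides are compared by scaling h with \<Delta> to the power 1/\<alpha>: above that
  level the first term of the rate dominates, below it the second one.\<close>
lemma rate_bounds:
  fixes \<alpha> h \<Delta> :: real
  assumes "1 < \<alpha>" "0 < h" "0 < \<Delta>"
  shows "\<Delta> / h \<le> h powr (\<alpha> - 1) + \<Delta> powr (1 + 1/\<alpha>) * h powr (-2)" (is "_ \<le> ?Q")
    "\<Delta> powr (1 - 1/\<alpha>) \<le> h powr (\<alpha> - 1) + \<Delta> powr (1 + 1/\<alpha>) * h powr (-2)"
proof -
  let ?l = "\<Delta> powr (1/\<alpha>)"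
  have l: "0 < ?l" "?l powr \<alpha> = \<Delta>" using assms by (simp_all add: powr_powr)
  have Q: "h powr (\<alpha> - 1) \<le> ?Q" "\<Delta> powr (1 + 1/\<alpha>) * h powr (-2) \<le> ?Q" by simp_all
  have pos: "0 < h powr (\<alpha> - 1)" using assms by simp
  show "\<Delta> / h \<le> ?Q"
  proof (cases "?l \<le> h")
    case True
    have "?l powr \<alpha> \<le> h powr \<alpha>" using True l assms by (intro powr_mono2) auto
    then have "\<Delta> / h \<le> h powr \<alpha> / h" using l assms by (simp add: divide_right_mono)
    also have "\<dots> = h powr (\<alpha> - 1)" using assms by (simp add: powr_diff)
    finally show ?thesis using Q by linarith
  next
    case False
    have "\<Delta> * h \<le> \<Delta> * ?l" using False assms by (intro mult_left_mono) auto
    then have "\<Delta> * h * h powr (-2) \<le> \<Delta> * ?l * h powr (-2)" by (intro mult_right_mono) auto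
    moreover have "\<Delta> * h * h powr (-2) = \<Delta> / h" using assms by (simp add: powr_minus powr_numeral power2_eq_square field_simps)
    moreover have "\<Delta> * ?l = \<Delta> powr (1 + 1/\<alpha>)" using assms by (simp add: powr_add)
    ultimately have "\<Delta> / h \<le> \<Delta> powr (1 + 1/\<alpha>) * h powr (-2)" by simp
    then show ?thesis using Q by linarith
  qed
  show "\<Delta> powr (1 - 1/\<alpha>) \<le> ?Q"
  proof (cases "?l \<le> h")
    case True
    have "\<Delta> powr (1 - 1/\<alpha>) = ?l powr (\<alpha> - 1)"
      unfolding powr_powr using assms by (intro arg_cong[where f="\<lambda>x. \<Delta> powr x"]) (simp add: field_simps)
    also have "\<dots> \<le> h powr (\<alpha> - 1)" using True assms by (intro powr_mono2) auto
    finally show ?thesis using Q by linarith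
  next
    case False
    have "\<Delta> powr (1 - 1/\<alpha>) = \<Delta> powr (1 + 1/\<alpha>) * ?l powr (-2)"
      unfolding powr_powr powr_add[symmetric] by (intro arg_cong[where f="\<lambda>x. \<Delta> powr x"]) simp
    also have "\<dots> \<le> \<Delta> powr (1 + 1/\<alpha>) * h powr (-2)"
      using False assms by (intro mult_left_mono powr_mono2') auto
    finally show ?thesis using Q pos by linarith
  qed
qed

section \<open>Second moment of the discretisation error\<close>

context stable_process
begin

text \<open>The 3 adds 1 for the window at s and 2 for the window at the grid time below s; the
  summands 1 and \<open>K0 / \<beta>\<close> weigh the near and the far lags.\<close>

definition grid_const :: real where
  "grid_const = 2 * (3 * K0 / (1 - \<beta>)) * (1 + K0 / \<beta>)"

lemma grid_const_nonneg: "0 \<le> grid_const"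
  unfolding grid_const_def using beta stable_moment_nonneg
  by (intro mult_nonneg_nonneg add_nonneg_nonneg divide_nonneg_nonneg) auto

text \<open>Near lags contribute length 2\<Delta> times height 1/(2h). The far ones, shifted by
  \<Delta>, still exceed \<Delta>, where r^(-\<beta>-1) integrates to \<Delta>^(-\<beta>) /
  \<beta>.\<close>

lemma nn_integral_shifted_powr_le:
  assumes "0 < \<Delta>" "0 < h"
  shows "(\<integral>\<^sup>+ r. ennreal (if r \<le> 2 * \<Delta> then 1 / (2 * h) else K0 * (\<Delta> * (r - \<Delta>) powr (- \<beta> - 1))) * indicator {0<..} r \<partial>lborel)
    \<le> ennreal (\<Delta> / h + K0 / \<beta> * \<Delta> powr (1 - \<beta>))"
proof -
  have K0: "0 \<le> K0 * \<Delta>" using stable_moment_nonneg assms by simp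
  have "(\<integral>\<^sup>+ r. ennreal (if r \<le> 2 * \<Delta> then 1 / (2 * h) else K0 * (\<Delta> * (r - \<Delta>) powr (- \<beta> - 1))) * indicator {0<..} r \<partial>lborel)
    \<le> (\<integral>\<^sup>+ r. ennreal (1 / (2 * h)) * indicator {0<..2 * \<Delta>} r
        + ennreal (K0 * \<Delta>) * (ennreal ((r - \<Delta>) powr (- \<beta> - 1)) * indicator {\<Delta><..} (r - \<Delta>)) \<partial>lborel)"
    using assms ennreal_mult[OF K0 powr_ge_zero]
    by (intro nn_integral_mono) (auto simp: indicator_def mult.assoc)
  also have "\<dots> = ennreal (1 / (2 * h)) * ennreal (2 * \<Delta>)
      + ennreal (K0 * \<Delta>) * (\<integral>\<^sup>+ r. ennreal ((r - \<Delta>) powr (- \<beta> - 1)) * indicator {\<Delta><..} (r - \<Delta>) \<partial>lborel)"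
    using assms by (simp add: nn_integral_add nn_integral_cmult)
  also have "(\<integral>\<^sup>+ r. ennreal ((r - \<Delta>) powr (- \<beta> - 1)) * indicator {\<Delta><..} (r - \<Delta>) \<partial>lborel)
      = (\<integral>\<^sup>+ r. ennreal (r powr (- \<beta> - 1)) * indicator {\<Delta><..} r \<partial>lborel)"
    by (subst nn_integral_real_affine[of _ 1 \<Delta>]) auto
  also have "ennreal (1 / (2 * h)) * ennreal (2 * \<Delta>) + ennreal (K0 * \<Delta>) * \<dots> \<le>
      ennreal (1 / (2 * h)) * ennreal (2 * \<Delta>) + ennreal (K0 * \<Delta>) * ennreal (- (\<Delta> powr (- \<beta> - 1 + 1) / (- \<beta> - 1 + 1)))"
    using beta assms by (intro add_left_mono mult_left_mono nn_integral_powr_to_inf) auto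
  also have "- (\<Delta> powr (- \<beta> - 1 + 1) / (- \<beta> - 1 + 1)) = \<Delta> powr (- \<beta>) / \<beta>" by simp
  also have "ennreal (1 / (2 * h)) * ennreal (2 * \<Delta>) + ennreal (K0 * \<Delta>) * ennreal (\<Delta> powr (- \<beta>) / \<beta>)
      = ennreal (1 / (2 * h) * (2 * \<Delta>) + K0 * \<Delta> * (\<Delta> powr (- \<beta>) / \<beta>))"
  proof -
    have "0 \<le> 1 / (2 * h)" "0 \<le> 2 * \<Delta>" "0 \<le> \<Delta> powr (- \<beta>) / \<beta>" using assms beta by auto
    note nn = this
    show ?thesis
      unfolding ennreal_mult[OF nn(1,2), symmetric] ennreal_mult[OF K0 nn(3), symmetric]
      by (rule ennreal_plus[symmetric]) (intro mult_nonneg_nonneg nn K0)+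
  qed
  also have "K0 * \<Delta> * (\<Delta> powr (- \<beta>) / \<beta>) = K0 / \<beta> * \<Delta> powr (1 - \<beta>)"
    using assms powr_add[of \<Delta> 1 "- \<beta>"] by simp
  finally show ?thesis using assms by simp
qed

lemma second_moment_grid_le:
  assumes "0 < \<Delta>" "0 < h" "0 < T"
  shows "(\<integral>\<^sup>+ \<omega>. ennreal ((LBINT s. indicator {0<..<T} s * (if s < \<Delta> then 0 else
        window h y (X (grid_floor \<Delta> s) \<omega>) - window h y (X (max 0 s) \<omega>)))\<^sup>2) \<partial>M)
    \<le> ennreal (grid_const * T powr (1 - \<beta>) * (h powr (\<alpha> - 1) + \<Delta> powr (1 + \<beta>) * h powr (-2)))"
proof -
  define Y where "Y s \<omega> = (if s < \<Delta> then 0 else window h y (X (grid_floor \<Delta> s) \<omega>) - window h y (X (max 0 s) \<omega>))" for s \<omega>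
  \<comment> \<open>Beyond lag 2\<Delta> the grid time below t lies after s, at distance more than t
    - s - \<Delta> > \<Delta>, so the smoothing effect of the increment is available. For shorter
    lags only boundedness of the window is used.\<close>
  define w where "w r = (if r \<le> 2 * \<Delta> then 1 / (2 * h) else K0 * (\<Delta> * (r - \<Delta>) powr (- \<beta> - 1)))" for r
  have [measurable]: "(\<lambda>(\<omega>, s). X (max 0 s) \<omega>) \<in> borel_measurable (M \<Otimes>\<^sub>M borel)"
      "(\<lambda>(\<omega>, s). X (grid_floor \<Delta> s) \<omega>) \<in> borel_measurable (M \<Otimes>\<^sub>M borel)"
    by (intro X_jointly_measurable grid_floor_nonneg; simp)+
  have win: "0 \<le> window h y x" "window h y x \<le> 1 / (2 * h)" for x
    using window_bounds[OF assms(2)] by auto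
  have bd: "\<bar>Y s \<omega>\<bar> \<le> 1 / (2 * h)" for s \<omega>
    using win[of "X (grid_floor \<Delta> s) \<omega>"] win[of "X (max 0 s) \<omega>"] assms by (auto simp: Y_def abs_le_iff)
  have [measurable]: "Y s \<in> borel_measurable M" for s unfolding Y_def[abs_def] by measurable
  have intw: "integrable M (\<lambda>\<omega>. window h y (X t \<omega>))" for t
    using window_abs_le[OF assms(2)] by (auto intro!: integrable_bounded_measurable)
  have m: "expectation (\<lambda>\<omega>. window h y (X (grid_floor \<Delta> s) \<omega>)) + expectation (\<lambda>\<omega>. window h y (X s \<omega>)) \<le> 3 * K0 * s powr (- \<beta>)"
    if "\<Delta> \<le> s" for s
  proof -
    let ?g = "grid_floor \<Delta> s"
    have g: "?g \<le> s" "s - \<Delta> < ?g" "\<Delta> \<le> ?g" using grid_floor_bounds[of \<Delta> s] assms that by auto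
    \<comment> \<open>The grid time is at least \<Delta> and exceeds s - \<Delta>; the larger of
      these two is at least s / 2.\<close>
    then have "?g powr (- \<beta>) \<le> (s / 2) powr (- \<beta>)" using assms that beta by (intro powr_mono2') auto
    also have "\<dots> = 2 powr \<beta> * s powr (- \<beta>)" using assms that by (simp add: powr_divide powr_minus divide_simps)
    also have "\<dots> \<le> 2 powr 1 * s powr (- \<beta>)" using beta by (intro mult_right_mono powr_mono) auto
    finally have "?g powr (- \<beta>) + s powr (- \<beta>) \<le> 3 * s powr (- \<beta>)" by simp
    then have "K0 * (?g powr (- \<beta>) + s powr (- \<beta>)) \<le> K0 * (3 * s powr (- \<beta>))"
      using stable_moment_nonneg by (intro mult_left_mono) auto
    then show ?thesis
      using expectation_window_le[of ?g h y] expectation_window_le[of s h y] g assms that by (simp add: algebra_simps)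
  qed
  have "(\<integral>\<^sup>+ \<omega>. ennreal ((LBINT s. indicator {0<..<T} s * Y s \<omega>)\<^sup>2) \<partial>M)
    \<le> 2 * ennreal (3 * K0 / (1 - \<beta>) * T powr (1 - \<beta>)) * ennreal (\<Delta> / h + K0 / \<beta> * \<Delta> powr (1 - \<beta>))"
  proof (rule second_moment_time_integral_le[where m="\<lambda>s. 3 * K0 * s powr (- \<beta>)" and w=w and b="1 / (2 * h)", OF _ bd])
    show "(\<lambda>(\<omega>, s). Y s \<omega>) \<in> borel_measurable (M \<Otimes>\<^sub>M borel)" unfolding Y_def by measurable
    show "\<bar>expectation (\<lambda>\<omega>. Y s \<omega> * Y t \<omega>)\<bar> \<le> 3 * K0 * s powr (- \<beta>) * w (t - s)"
      if st: "0 < s" "s < t" "t < T" for s t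
    proof (cases "s < \<Delta>")
      case True
      then have "expectation (\<lambda>\<omega>. Y s \<omega> * Y t \<omega>) = 0" by (simp add: Y_def)
      moreover have "0 \<le> w (t - s)" using assms stable_moment_nonneg by (simp add: w_def)
      ultimately show ?thesis using stable_moment_nonneg by simp
    next
      case False
      let ?gs = "grid_floor \<Delta> s" and ?gt = "grid_floor \<Delta> t"
      have gs: "?gs \<le> s" "s - \<Delta> < ?gs" "\<Delta> \<le> ?gs" and gt: "?gt \<le> t" "t - \<Delta> < ?gt"
        using grid_floor_bounds[of \<Delta> s] grid_floor_bounds[of \<Delta> t] assms st False by auto
      have Ys: "Y s \<omega> = window h y (X ?gs \<omega>) - window h y (X s \<omega>)" for \<omega>
        using False st by (simp add: Y_def max_absorb2)
      have Yt: "Y t \<omega> = window h y (X ?gt \<omega>) - window h y (X t \<omega>)" for \<omega>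
        using False st by (simp add: Y_def max_absorb2)
      show ?thesis
      proof (cases "t - s \<le> 2 * \<Delta>")
        case True
        \<comment> \<open>One factor is replaced by its supremum 1/(2h); the mean of the other
          supplies the marginal decay in s.\<close>
        have "\<bar>expectation (\<lambda>\<omega>. Y s \<omega> * Y t \<omega>)\<bar>
            \<le> expectation (\<lambda>\<omega>. (window h y (X ?gs \<omega>) + window h y (X s \<omega>)) * (1 / (2 * h)))"
        proof (rule order_trans[OF integral_abs_bound integral_mono])
          have "integrable M (\<lambda>\<omega>. Y s \<omega> * Y t \<omega>)"
            using bd[of s] bd[of t] assms
            by (intro integrable_const_bound[of _ "1 / (2 * h) * (1 / (2 * h))"]) (auto simp only: abs_mult real_norm_def intro!: mult_mono AE_I2, auto)
          then show "integrable M (\<lambda>\<omega>. \<bar>Y s \<omega> * Y t \<omega>\<bar>)" by simp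
          show "integrable M (\<lambda>\<omega>. (window h y (X ?gs \<omega>) + window h y (X s \<omega>)) * (1 / (2 * h)))"
            using intw by simp
          show "\<bar>Y s \<omega> * Y t \<omega>\<bar> \<le> (window h y (X ?gs \<omega>) + window h y (X s \<omega>)) * (1 / (2 * h))" for \<omega>
            unfolding abs_mult
          proof (rule mult_mono[OF _ bd])
            show "\<bar>Y s \<omega>\<bar> \<le> window h y (X ?gs \<omega>) + window h y (X s \<omega>)"
              using win(1)[of "X ?gs \<omega>"] win(1)[of "X s \<omega>"] by (simp add: Ys abs_le_iff)
          qed (use win(1) in auto)
        qed
        also have "\<dots> = (expectation (\<lambda>\<omega>. window h y (X ?gs \<omega>)) + expectation (\<lambda>\<omega>. window h y (X s \<omega>))) * (1 / (2 * h))"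
          using intw by (subst integral_mult_left_zero) simp
        also have "\<dots> \<le> 3 * K0 * s powr (- \<beta>) * (1 / (2 * h))"
          using m[of s] False assms by (intro mult_right_mono) auto
        finally show ?thesis using True by (simp add: w_def)
      next
        case far: False
        \<comment> \<open>\<open>Y s\<close> involves two positions, at s and at the grid time below
          it. The Markov property is applied from each separately, with a standing for either time,
          and the results are added.\<close>
        have step: "\<bar>expectation (\<lambda>\<omega>. window h y (X a \<omega>) * Y t \<omega>)\<bar> \<le> expectation (\<lambda>\<omega>. window h y (X a \<omega>)) * w (t - s)"
          if a: "0 \<le> a" "a \<le> s" for a
        proof -
          have "?gt - a + (t - ?gt) = t - a" by simp
          then have "(?gt - a) powr (- \<beta>) - (t - a) powr (- \<beta>) \<le> (t - ?gt) * (t - s - \<Delta>) powr (- \<beta> - 1)"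
            using powr_increment_le[of "t - s - \<Delta>" "?gt - a" "t - ?gt" \<beta>] far gt a assms beta by simp
          also have "\<dots> \<le> \<Delta> * (t - s - \<Delta>) powr (- \<beta> - 1)" using gt by (intro mult_right_mono) auto
          finally have "K0 * ((?gt - a) powr (- \<beta>) - (t - a) powr (- \<beta>)) \<le> w (t - s)"
            using far stable_moment_nonneg by (simp add: w_def mult_left_mono)
          then have "expectation (\<lambda>\<omega>. window h y (X a \<omega>)) * (K0 * ((?gt - a) powr (- \<beta>) - (t - a) powr (- \<beta>)))
              \<le> expectation (\<lambda>\<omega>. window h y (X a \<omega>)) * w (t - s)"
            using win by (intro mult_left_mono integral_nonneg_AE) auto
          moreover have "\<bar>expectation (\<lambda>\<omega>. window h y (X a \<omega>) * Y t \<omega>)\<bar>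
              \<le> expectation (\<lambda>\<omega>. window h y (X a \<omega>)) * (K0 * ((?gt - a) powr (- \<beta>) - (t - a) powr (- \<beta>)))"
            unfolding Yt using a far gt assms by (intro window_time_covariance) auto
          ultimately show ?thesis by linarith
        qed
        have intY: "integrable M (\<lambda>\<omega>. window h y (X a \<omega>) * Y t \<omega>)" for a
          using bd[of t] window_abs_le[OF assms(2)] assms
          by (intro integrable_const_bound[of _ "1 / (2 * h) * (1 / (2 * h))"]) (auto simp only: abs_mult real_norm_def intro!: mult_mono AE_I2, auto)
        have "expectation (\<lambda>\<omega>. Y s \<omega> * Y t \<omega>)
            = expectation (\<lambda>\<omega>. window h y (X ?gs \<omega>) * Y t \<omega>) - expectation (\<lambda>\<omega>. window h y (X s \<omega>) * Y t \<omega>)"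
          unfolding Ys left_diff_distrib by (rule Bochner_Integration.integral_diff[OF intY intY])
        then have "\<bar>expectation (\<lambda>\<omega>. Y s \<omega> * Y t \<omega>)\<bar>
            \<le> expectation (\<lambda>\<omega>. window h y (X ?gs \<omega>)) * w (t - s) + expectation (\<lambda>\<omega>. window h y (X s \<omega>)) * w (t - s)"
          using step[of ?gs] step[of s] gs assms st by linarith
        also have "\<dots> = (expectation (\<lambda>\<omega>. window h y (X ?gs \<omega>)) + expectation (\<lambda>\<omega>. window h y (X s \<omega>))) * w (t - s)"
          by (simp add: distrib_right)
        also have "\<dots> \<le> 3 * K0 * s powr (- \<beta>) * w (t - s)"
          using m[of s] False assms stable_moment_nonneg by (intro mult_right_mono) (auto simp: w_def)
        finally show ?thesis .
      qed
    qed
    show "(\<integral>\<^sup>+ s. ennreal (3 * K0 * s powr (- \<beta>)) * indicator {0<..<T} s \<partial>lborel) \<le> ennreal (3 * K0 / (1 - \<beta>) * T powr (1 - \<beta>))"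
      using assms stable_moment_nonneg by (intro nn_integral_marginal_le) auto
    show "(\<integral>\<^sup>+ r. ennreal (w r) * indicator {0<..} r \<partial>lborel) \<le> ennreal (\<Delta> / h + K0 / \<beta> * \<Delta> powr (1 - \<beta>))"
      unfolding w_def by (rule nn_integral_shifted_powr_le) fact+
    show "w \<in> borel_measurable borel" unfolding w_def[abs_def] by measurable
  qed (use assms stable_moment_nonneg in auto)
  also have "\<dots> \<le> ennreal (grid_const * T powr (1 - \<beta>) * (h powr (\<alpha> - 1) + \<Delta> powr (1 + \<beta>) * h powr (-2)))"
  proof -
    let ?Q = "h powr (\<alpha> - 1) + \<Delta> powr (1 + \<beta>) * h powr (-2)"
    have nn: "0 \<le> 3 * K0 / (1 - \<beta>) * T powr (1 - \<beta>)" using beta stable_moment_nonneg by simp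
    have k: "0 \<le> K0 / \<beta>" using beta stable_moment_nonneg by simp
    have "\<Delta> / h + K0 / \<beta> * \<Delta> powr (1 - \<beta>) \<le> ?Q + K0 / \<beta> * ?Q"
      using rate_bounds[OF alpha(1) assms(2,1)] k by (intro add_mono mult_left_mono) auto
    then have "ennreal (\<Delta> / h + K0 / \<beta> * \<Delta> powr (1 - \<beta>)) \<le> ennreal ((1 + K0 / \<beta>) * ?Q)"
      by (intro ennreal_leI) (simp only: distrib_right mult_1)
    then have "2 * ennreal (3 * K0 / (1 - \<beta>) * T powr (1 - \<beta>)) * ennreal (\<Delta> / h + K0 / \<beta> * \<Delta> powr (1 - \<beta>))
        \<le> 2 * ennreal (3 * K0 / (1 - \<beta>) * T powr (1 - \<beta>)) * ennreal ((1 + K0 / \<beta>) * ?Q)"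
      by (intro mult_mono) auto
    also have "\<dots> = ennreal (2 * (3 * K0 / (1 - \<beta>) * T powr (1 - \<beta>)) * ((1 + K0 / \<beta>) * ?Q))"
      using k by (intro two_ennreal_mult nn mult_nonneg_nonneg add_nonneg_nonneg) auto
    finally show ?thesis by (simp only: grid_const_def times_divide_eq_left times_divide_eq_right mult_ac)
  qed
  finally show ?thesis by (simp only: Y_def)
qed

end

section \<open>The local time estimator\<close>

context stable_process
begin

lemma window_path_measurable:
  assumes "\<omega> \<in> space M"
  shows "(\<lambda>s. window h y (X (max 0 s) \<omega>)) \<in> borel_measurable borel"
    and "(\<lambda>s. window h y (X (grid_floor \<Delta> s) \<omega>)) \<in> borel_measurable borel"
proof -
  have path: "(\<lambda>s. X (\<tau> s) \<omega>) \<in> borel_measurable borel" if "\<tau> \<in> borel_measurable borel" "\<And>s. 0 \<le> \<tau> s" for \<tau>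
    using measurable_compose[OF measurable_Pair1'[OF assms] X_jointly_measurable[OF that]] by simp
  show "(\<lambda>s. window h y (X (max 0 s) \<omega>)) \<in> borel_measurable borel"
    by (rule measurable_compose[OF path window_measurable]) auto
  show "(\<lambda>s. window h y (X (grid_floor \<Delta> s) \<omega>)) \<in> borel_measurable borel"
    by (rule measurable_compose[OF path window_measurable]) (auto simp: grid_floor_nonneg)
qed

lemma integrable_window_path:
  assumes "\<omega> \<in> space M" "0 < h"
  shows "integrable lborel (\<lambda>s. indicator {a<..<b} s * window h y (X (max 0 s) \<omega>))"
    and "integrable lborel (\<lambda>s. indicator {a<..<b} s * window h y (X (grid_floor \<Delta> s) \<omega>))"
proof -
  have fin: "emeasure lborel {a<..<b} < \<infinity>" by (cases "a \<le> b") auto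
  have *: "integrable lborel (\<lambda>s. indicator {a<..<b} s * f s)"
    if "f \<in> borel_measurable borel" "\<And>s. \<bar>f s\<bar> \<le> 1 / (2 * h)" for f :: "real \<Rightarrow> real"
    by (rule integrableI_bounded_set[where A="{a<..<b}" and B="1 / (2 * h)"])
      (use that fin in \<open>auto simp: indicator_def\<close>)
  show "integrable lborel (\<lambda>s. indicator {a<..<b} s * window h y (X (max 0 s) \<omega>))"
    by (rule *[OF window_path_measurable(1)[OF assms(1)] window_abs_le[OF assms(2)]])
  show "integrable lborel (\<lambda>s. indicator {a<..<b} s * window h y (X (grid_floor \<Delta> s) \<omega>))"
    by (rule *[OF window_path_measurable(2)[OF assms(1)] window_abs_le[OF assms(2)]])
qed

text \<open>The quantity A_h of the overview, with \<open>max 0\<close> inserted so that joint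
  measurability applies.\<close>

definition occupation_avg :: "real \<Rightarrow> real \<Rightarrow> real \<Rightarrow> 'a \<Rightarrow> real" where
  "occupation_avg T h y \<omega> = (LBINT s. indicator {0<..<T} s * window h y (X (max 0 s) \<omega>))"

lemma estimator_decomposition:
  assumes \<omega>: "\<omega> \<in> space M" and "0 < T" "0 < n" "0 < h" "0 < h'"
  defines "\<Delta> \<equiv> T / real n"
  shows "(local_time_est X T n h y \<omega> - occupation_avg T h' y \<omega>)\<^sup>2 \<le>
     3 * (\<Delta> / (2 * h))\<^sup>2
     + 3 * (LBINT s. indicator {0<..<T} s * (if s < \<Delta> then 0 else window h y (X (grid_floor \<Delta> s) \<omega>) - window h y (X (max 0 s) \<omega>)))\<^sup>2
     + 3 * (LBINT s. indicator {0<..<T} s * (window h y (X (max 0 s) \<omega>) - window h' y (X (max 0 s) \<omega>)))\<^sup>2"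
proof -
  have \<Delta>: "0 < \<Delta>" "\<Delta> \<le> T" using assms by (auto simp: \<Delta>_def divide_le_eq)
  let ?g = "\<lambda>s. window h y (X (grid_floor \<Delta> s) \<omega>)" and ?f = "\<lambda>s. window h y (X (max 0 s) \<omega>)"
    and ?f' = "\<lambda>s. window h' y (X (max 0 s) \<omega>)"
  note int = integrable_window_path[OF \<omega> \<open>0 < h\<close>] integrable_window_path(1)[OF \<omega> \<open>0 < h'\<close>]
  define D1 where "D1 = (LBINT s. indicator {0<..<\<Delta>} s * ?g s - indicator {0<..<\<Delta>} s * ?f s)"
  define D2 where "D2 = (LBINT s. indicator {0<..<T} s * (if s < \<Delta> then 0 else ?g s - ?f s))"
  define D3 where "D3 = (LBINT s. indicator {0<..<T} s * (?f s - ?f' s))"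
  have eq: "indicator {0<..<T} s * (if s < \<Delta> then 0 else ?g s - ?f s)
      = (indicator {0<..<T} s * ?g s - indicator {0<..<T} s * ?f s)
        - (indicator {0<..<\<Delta>} s * ?g s - indicator {0<..<\<Delta>} s * ?f s)" for s
    using \<Delta> by (auto simp: indicator_def)
  have D2: "D2 = (LBINT s. indicator {0<..<T} s * ?g s) - occupation_avg T h y \<omega> - D1"
    unfolding D2_def D1_def eq occupation_avg_def using int by simp
  have D3: "D3 = occupation_avg T h y \<omega> - occupation_avg T h' y \<omega>"
    unfolding D3_def right_diff_distrib occupation_avg_def using int by simp
  have "local_time_est X T n h y \<omega> - occupation_avg T h' y \<omega> = D1 + D2 + D3"
    using local_time_est_eq_integral[OF \<open>0 < T\<close> \<open>0 < n\<close>, of X h y \<omega>] D2 D3 by (simp add: \<Delta>_def)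
  then have "(local_time_est X T n h y \<omega> - occupation_avg T h' y \<omega>)\<^sup>2 = (D1 + D2 + D3)\<^sup>2" by simp
  \<comment> \<open>The right side minus the left side is the sum of the squares of
    \<open>D1 - D2\<close>, \<open>D2 - D3\<close> and \<open>D1 - D3\<close>.\<close>
  moreover have "(D1 + D2 + D3)\<^sup>2 \<le> 3 * D1\<^sup>2 + 3 * D2\<^sup>2 + 3 * D3\<^sup>2"
    using sum_squares_ge_zero[of "D1 - D2" "D2 - D3"] zero_le_power2[of "D1 - D3"]
    by (simp add: power2_eq_square algebra_simps)
  moreover have "D1\<^sup>2 \<le> (\<Delta> / (2 * h))\<^sup>2"
  proof -
    \<comment> \<open>Both windows take values in [0, 1/(2h)], so their difference is at most
      1/(2h), not 1/h, in absolute value.\<close>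
    have "\<bar>D1\<bar> \<le> (LBINT s. indicator {0<..<\<Delta>} s * (1 / (2 * h)))"
      unfolding D1_def
    proof (rule order_trans[OF integral_abs_bound integral_mono])
      show "\<bar>indicator {0<..<\<Delta>} s * ?g s - indicator {0<..<\<Delta>} s * ?f s\<bar> \<le> indicator {0<..<\<Delta>} s * (1 / (2 * h))" for s
        using window_bounds[OF \<open>0 < h\<close>, of y "X (grid_floor \<Delta> s) \<omega>"] window_bounds[OF \<open>0 < h\<close>, of y "X (max 0 s) \<omega>"]
        by (auto simp: indicator_def abs_le_iff)
    qed (use int \<Delta> in auto)
    also have "\<dots> = \<Delta> / (2 * h)" using \<Delta> by simp
    finally show ?thesis using abs_le_square_iff[of D1 "\<Delta> / (2 * h)"] \<Delta> \<open>0 < h\<close> by simp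
  qed
  ultimately have "(local_time_est X T n h y \<omega> - occupation_avg T h' y \<omega>)\<^sup>2 \<le> 3 * (\<Delta> / (2 * h))\<^sup>2 + 3 * D2\<^sup>2 + 3 * D3\<^sup>2"
    by linarith
  then show ?thesis unfolding D2_def D3_def .
qed

lemma second_moment_estimator_occupation_avg:
  assumes "0 < T" "0 < n" "0 < h'" "h' \<le> h"
  defines "\<Delta> \<equiv> T / real n"
  shows "(\<integral>\<^sup>+ \<omega>. ennreal ((local_time_est X T n h y \<omega> - occupation_avg T h' y \<omega>)\<^sup>2) \<partial>M)
    \<le> ennreal (3 * (1 + grid_const + width_const) * (T powr (1 - \<beta>) * (h powr (\<alpha> - 1) + \<Delta> powr (1 + \<beta>) * h powr (-2))))"
proof -
  have h: "0 < h" using assms by simp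
  have \<Delta>: "0 < \<Delta>" "\<Delta> \<le> T" using assms by (auto simp: \<Delta>_def divide_le_eq)
  let ?Q = "h powr (\<alpha> - 1) + \<Delta> powr (1 + \<beta>) * h powr (-2)"
  let ?D2 = "\<lambda>\<omega>. (LBINT s. indicator {0<..<T} s * (if s < \<Delta> then 0 else window h y (X (grid_floor \<Delta> s) \<omega>) - window h y (X (max 0 s) \<omega>)))\<^sup>2"
  let ?D3 = "\<lambda>\<omega>. (LBINT s. indicator {0<..<T} s * (window h y (X (max 0 s) \<omega>) - window h' y (X (max 0 s) \<omega>)))\<^sup>2"
  have [measurable]: "(\<lambda>(\<omega>, s). X (max 0 s) \<omega>) \<in> borel_measurable (M \<Otimes>\<^sub>M borel)"
      "(\<lambda>(\<omega>, s). X (grid_floor \<Delta> s) \<omega>) \<in> borel_measurable (M \<Otimes>\<^sub>M borel)"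
    by (intro X_jointly_measurable grid_floor_nonneg; simp)+
  have [measurable]: "?D2 \<in> borel_measurable M" "?D3 \<in> borel_measurable M"
    by (intro borel_measurable_power lborel.borel_measurable_lebesgue_integral; simp add: measurable_cong_sets[OF sets_pair_measure_cong[OF refl sets_lborel] refl]; measurable)+
  have "(\<integral>\<^sup>+ \<omega>. ennreal ((local_time_est X T n h y \<omega> - occupation_avg T h' y \<omega>)\<^sup>2) \<partial>M)
      \<le> (\<integral>\<^sup>+ \<omega>. 3 * ennreal ((\<Delta> / (2 * h))\<^sup>2) + 3 * ennreal (?D2 \<omega>) + 3 * ennreal (?D3 \<omega>) \<partial>M)"
  proof (rule nn_integral_mono)
    fix \<omega> assume "\<omega> \<in> space M"
    from estimator_decomposition[OF this assms(1,2) h assms(3), of y, folded \<Delta>_def]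
    have "ennreal ((local_time_est X T n h y \<omega> - occupation_avg T h' y \<omega>)\<^sup>2)
        \<le> ennreal (3 * (\<Delta> / (2 * h))\<^sup>2 + 3 * ?D2 \<omega> + 3 * ?D3 \<omega>)" by (rule ennreal_leI)
    also have "\<dots> = 3 * ennreal ((\<Delta> / (2 * h))\<^sup>2) + 3 * ennreal (?D2 \<omega>) + 3 * ennreal (?D3 \<omega>)"
      by (simp add: ennreal_mult del: power_divide)
    finally show "ennreal ((local_time_est X T n h y \<omega> - occupation_avg T h' y \<omega>)\<^sup>2)
        \<le> 3 * ennreal ((\<Delta> / (2 * h))\<^sup>2) + 3 * ennreal (?D2 \<omega>) + 3 * ennreal (?D3 \<omega>)" .
  qed
  also have "\<dots> = 3 * ennreal ((\<Delta> / (2 * h))\<^sup>2) + 3 * (\<integral>\<^sup>+ \<omega>. ennreal (?D2 \<omega>) \<partial>M) + 3 * (\<integral>\<^sup>+ \<omega>. ennreal (?D3 \<omega>) \<partial>M)"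
    by (simp add: nn_integral_add nn_integral_cmult emeasure_space_1 del: power_divide)
  also have "\<dots> \<le> 3 * ennreal (T powr (1 - \<beta>) * ?Q) + 3 * ennreal (grid_const * T powr (1 - \<beta>) * ?Q)
      + 3 * ennreal (width_const * T powr (1 - \<beta>) * ?Q)"
  proof (intro add_mono mult_left_mono)
    \<comment> \<open>The first cell fits the rate because \<Delta>^2 = \<Delta>^(1-\<beta>)
      \<Delta>^(1+\<beta>) and \<Delta> \<le> T: the first factor is traded for
      T^(1-\<beta>).\<close>
    have "(\<Delta> / (2 * h))\<^sup>2 \<le> \<Delta> powr 2 * h powr (-2)"
      using \<Delta> h by (simp add: powr_minus power_divide field_simps)
    also have "\<Delta> powr 2 = \<Delta> powr (1 - \<beta>) * \<Delta> powr (1 + \<beta>)" by (simp add: powr_add[symmetric])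
    also have "\<Delta> powr (1 - \<beta>) * \<Delta> powr (1 + \<beta>) * h powr (-2) \<le> T powr (1 - \<beta>) * (\<Delta> powr (1 + \<beta>) * h powr (-2))"
      unfolding mult.assoc using \<Delta> beta by (intro mult_right_mono powr_mono2) auto
    also have "\<dots> \<le> T powr (1 - \<beta>) * ?Q" by (intro mult_left_mono) auto
    finally show "ennreal ((\<Delta> / (2 * h))\<^sup>2) \<le> ennreal (T powr (1 - \<beta>) * ?Q)" by (rule ennreal_leI)
    show "(\<integral>\<^sup>+ \<omega>. ennreal (?D2 \<omega>) \<partial>M) \<le> ennreal (grid_const * T powr (1 - \<beta>) * ?Q)"
      by (rule second_moment_grid_le) (use \<Delta> h assms in auto)
    have "(\<integral>\<^sup>+ \<omega>. ennreal (?D3 \<omega>) \<partial>M) \<le> ennreal (width_const * T powr (1 - \<beta>) * h powr (\<alpha> - 1))"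
      by (rule second_moment_width_le) (use assms in auto)
    also have "\<dots> \<le> ennreal (width_const * T powr (1 - \<beta>) * ?Q)"
      using width_const_nonneg by (intro ennreal_leI mult_left_mono) auto
    finally show "(\<integral>\<^sup>+ \<omega>. ennreal (?D3 \<omega>) \<partial>M) \<le> ennreal (width_const * T powr (1 - \<beta>) * ?Q)" .
  qed auto
  also have "\<dots> = ennreal (3 * (1 + grid_const + width_const) * (T powr (1 - \<beta>) * ?Q))"
  proof -
    have three: "3 * ennreal x = ennreal (3 * x)" if "0 \<le> x" for x using that by (simp add: ennreal_mult)
    have Q: "0 \<le> ?Q" by simp
    have nn: "0 \<le> T powr (1 - \<beta>) * ?Q" "0 \<le> grid_const * T powr (1 - \<beta>) * ?Q" "0 \<le> width_const * T powr (1 - \<beta>) * ?Q"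
      by (intro mult_nonneg_nonneg grid_const_nonneg width_const_nonneg Q powr_ge_zero)+
    have "3 * ennreal (T powr (1 - \<beta>) * ?Q) + 3 * ennreal (grid_const * T powr (1 - \<beta>) * ?Q)
        + 3 * ennreal (width_const * T powr (1 - \<beta>) * ?Q)
      = ennreal (3 * (T powr (1 - \<beta>) * ?Q) + 3 * (grid_const * T powr (1 - \<beta>) * ?Q) + 3 * (width_const * T powr (1 - \<beta>) * ?Q))"
      unfolding three[OF nn(1)] three[OF nn(2)] three[OF nn(3)]
      using nn by (subst ennreal_plus; simp del: times_divide_eq_left times_divide_eq_right)+
    also have "3 * (T powr (1 - \<beta>) * ?Q) + 3 * (grid_const * T powr (1 - \<beta>) * ?Q) + 3 * (width_const * T powr (1 - \<beta>) * ?Q)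
        = 3 * (1 + grid_const + width_const) * (T powr (1 - \<beta>) * ?Q)"
      by (simp only: distrib_left distrib_right mult_1_right mult.assoc)
    finally show ?thesis .
  qed
  finally show ?thesis .
qed

text \<open>By the occupation formula, the path average over width h is the mean of the local time
  over [y - h, y + h]; continuity in the level identifies the limit for every such path.\<close>

lemma occupation_avg_tendsto_local_time:
  fixes L :: "real \<Rightarrow> real \<Rightarrow> 'a \<Rightarrow> real"
  assumes \<omega>: "\<omega> \<in> space M" and "0 < T"
    and cont: "continuous_on UNIV (\<lambda>y. L T y \<omega>)" and Lpos: "0 \<le> L T y \<omega>"
    and occ: "\<And>f :: real \<Rightarrow> ennreal. f \<in> borel_measurable borel \<Longrightarrow>
           (\<integral>\<^sup>+ s. f (X s \<omega>) * indicator {0..T} s \<partial>lborel) = (\<integral>\<^sup>+ x. f x * ennreal (L T x \<omega>) \<partial>lborel)"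
    and \<delta>: "\<delta> \<longlonglongrightarrow> 0" "\<And>i. 0 < \<delta> i"
  shows "(\<lambda>i. occupation_avg T (\<delta> i) y \<omega>) \<longlonglongrightarrow> L T y \<omega>"
proof -
  have avg: "ennreal (occupation_avg T h y \<omega>) = ennreal (1 / (2 * h)) * (\<integral>\<^sup>+ x. indicator {y - h..y + h} x * ennreal (L T x \<omega>) \<partial>lborel)"
    if "0 < h" for h
  proof -
    have pos: "0 \<le> indicator {0<..<T} s * window h y (X (max 0 s) \<omega>)" for s
      using window_bounds(1)[OF that] by simp
    have "ennreal (occupation_avg T h y \<omega>) = (\<integral>\<^sup>+ s. ennreal (indicator {0<..<T} s * window h y (X (max 0 s) \<omega>)) \<partial>lborel)"
      unfolding occupation_avg_def using integrable_window_path(1)[OF \<omega> that] pos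
      by (intro nn_integral_eq_integral[symmetric]) auto
    also have "\<dots> = (\<integral>\<^sup>+ s. ennreal (window h y (X s \<omega>)) * indicator {0..T} s \<partial>lborel)"
    proof (rule nn_integral_cong_AE)
      have "AE s in lborel. s \<noteq> (0::real)" "AE s in lborel. s \<noteq> T" by (rule AE_lborel_singleton)+
      then show "AE s in lborel. ennreal (indicator {0<..<T} s * window h y (X (max 0 s) \<omega>)) = ennreal (window h y (X s \<omega>)) * indicator {0..T} s"
        by eventually_elim (auto simp: indicator_def max_absorb2)
    qed
    also have "\<dots> = (\<integral>\<^sup>+ x. ennreal (window h y x) * ennreal (L T x \<omega>) \<partial>lborel)"
      by (rule occ[of "\<lambda>x. ennreal (window h y x)"]) measurable
    also have "\<dots> = (\<integral>\<^sup>+ x. ennreal (1 / (2 * h)) * (indicator {y - h..y + h} x * ennreal (L T x \<omega>)) \<partial>lborel)"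
      by (intro nn_integral_cong) (auto simp: window_def indicator_def)
    also have "\<dots> = ennreal (1 / (2 * h)) * (\<integral>\<^sup>+ x. indicator {y - h..y + h} x * ennreal (L T x \<omega>) \<partial>lborel)"
      using borel_measurable_continuous_onI[OF cont] by (intro nn_integral_cmult) measurable
    finally show ?thesis .
  qed
  have const: "ennreal (1 / (2 * h)) * (\<integral>\<^sup>+ x. indicator {y - h..y + h} x * ennreal c \<partial>lborel) = ennreal c" if "0 < h" for h c
  proof -
    have "ennreal (1 / (2 * h)) * (\<integral>\<^sup>+ x. indicator {y - h..y + h} x * ennreal c \<partial>lborel) = ennreal (1 / (2 * h)) * (ennreal (2 * h) * ennreal c)"
      using that by (simp add: nn_integral_multc)
    moreover have "ennreal (1 / (2 * h)) * ennreal (2 * h) = 1"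
      using that by (subst ennreal_mult'[symmetric]) auto
    ultimately show ?thesis by (simp only: mult.assoc[symmetric] mult_1)
  qed
  have avg0: "0 \<le> occupation_avg T h y \<omega>" if "0 < h" for h
    unfolding occupation_avg_def using window_bounds(1)[OF that] by (intro integral_nonneg_AE) auto
  show ?thesis
  proof (rule LIMSEQ_I)
    fix e :: real assume "0 < e"
    then have e2: "0 < e / 2" by simp
    have "isCont (\<lambda>y. L T y \<omega>) y" using cont by (simp add: continuous_on_eq_continuous_at)
    then obtain d where d: "0 < d" "\<And>x. dist x y < d \<Longrightarrow> dist (L T x \<omega>) (L T y \<omega>) < e / 2"
      unfolding continuous_at_eps_delta using e2 by blast
    obtain N where N: "\<And>i. N \<le> i \<Longrightarrow> \<bar>\<delta> i\<bar> < d" using LIMSEQ_D[OF \<delta>(1) d(1)] by auto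
    have "norm (occupation_avg T (\<delta> i) y \<omega> - L T y \<omega>) < e" if "N \<le> i" for i
    proof -
      let ?h = "\<delta> i"
      have h: "0 < ?h" "?h < d" using \<delta>(2)[of i] N[OF that] by auto
      have near: "L T y \<omega> - e / 2 \<le> L T x \<omega>" "L T x \<omega> \<le> L T y \<omega> + e / 2" if "x \<in> {y - ?h..y + ?h}" for x
      proof -
        have "dist x y < d" using that h by (auto simp: dist_real_def)
        from d(2)[OF this] show "L T y \<omega> - e / 2 \<le> L T x \<omega>" "L T x \<omega> \<le> L T y \<omega> + e / 2"
          unfolding dist_real_def by linarith+
      qed
      have "ennreal (occupation_avg T ?h y \<omega>) \<le> ennreal (1 / (2 * ?h)) * (\<integral>\<^sup>+ x. indicator {y - ?h..y + ?h} x * ennreal (L T y \<omega> + e / 2) \<partial>lborel)"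
        unfolding avg[OF h(1)] using near by (intro mult_left_mono[OF nn_integral_mono]) (auto intro!: ennreal_leI split: split_indicator)
      then have up: "ennreal (occupation_avg T ?h y \<omega>) \<le> ennreal (L T y \<omega> + e / 2)" unfolding const[OF h(1)] .
      have "ennreal (1 / (2 * ?h)) * (\<integral>\<^sup>+ x. indicator {y - ?h..y + ?h} x * ennreal (L T y \<omega> - e / 2) \<partial>lborel) \<le> ennreal (occupation_avg T ?h y \<omega>)"
        unfolding avg[OF h(1)] using near by (intro mult_left_mono[OF nn_integral_mono]) (auto intro!: ennreal_leI split: split_indicator)
      then have lo: "ennreal (L T y \<omega> - e / 2) \<le> ennreal (occupation_avg T ?h y \<omega>)" unfolding const[OF h(1)] .
      \<comment> \<open>\<open>ennreal\<close> truncates a negative lower level to 0; nonnegativity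
        of the average recovers the inequality between reals in that case too.\<close>
      have lo': "L T y \<omega> - e / 2 \<le> occupation_avg T ?h y \<omega>"
        using lo avg0[OF h(1)] by (simp add: ennreal_le_iff)
      have up': "occupation_avg T ?h y \<omega> \<le> L T y \<omega> + e / 2"
        using up Lpos \<open>0 < e\<close> by (subst (asm) ennreal_le_iff) simp_all
      show ?thesis using lo' up' \<open>0 < e\<close> by (simp add: abs_less_iff)
    qed
    then show "\<exists>N. \<forall>i\<ge>N. norm (occupation_avg T (\<delta> i) y \<omega> - L T y \<omega>) < e" by blast
  qed
qed

end

section \<open>Passage from occupation averages to the local time\<close>

theorem theorem4:
  fixes M :: "'a measure" and \<alpha> :: real
    and X :: "real \<Rightarrow> 'a \<Rightarrow> real" and L :: "real \<Rightarrow> real \<Rightarrow> 'a \<Rightarrow> real"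
    and y :: real
  assumes "1 < \<alpha>" and "\<alpha> \<le> 2"
    and "sym_stable_levy M \<alpha> X"
    and "is_local_time M X L"
  shows "\<exists>\<epsilon>0>0. \<forall>\<epsilon>. 0 < \<epsilon> \<and> \<epsilon> < \<epsilon>0 \<longrightarrow>
           (\<exists>C<\<infinity>. C \<ge> 0 \<and>
             (\<forall>T>0. \<forall>n>0. \<forall>h>0.
                (\<integral>\<^sup>+ \<omega>. ennreal ((local_time_est X T n h y \<omega> - L T y \<omega>)\<^sup>2) \<partial>M)
                  \<le> C * ennreal (max 1 (T powr (-\<epsilon>)) * T powr (1 - 1/\<alpha>)
                       * (h powr (\<alpha> - 1) + (T / real n) powr (1 + 1/\<alpha>) * h powr (-2)))) \<and>
             (\<forall>T>0. \<forall>n>0.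
                ennreal ((T / real n) powr (1/\<alpha> - 1)) *
                (\<integral>\<^sup>+ \<omega>. ennreal ((local_time_est X T n ((T / real n) powr (1/\<alpha>)) y \<omega> - L T y \<omega>)\<^sup>2) \<partial>M)
                  \<le> C * ennreal (max 1 (T powr (-\<epsilon>)) * T powr (1 - 1/\<alpha>))))"
proof -
  interpret stable_process M \<alpha> X
    using assms by (auto simp: stable_process_def stable_process_axioms_def sym_stable_levy_def)
  define c where "c = 3 * (1 + grid_const + width_const)"
  have c: "0 \<le> c" using grid_const_nonneg width_const_nonneg by (simp add: c_def)
  have main: "(\<integral>\<^sup>+ \<omega>. ennreal ((local_time_est X T n h y \<omega> - L T y \<omega>)\<^sup>2) \<partial>M)
      \<le> ennreal (c * (T powr (1 - \<beta>) * (h powr (\<alpha> - 1) + (T / real n) powr (1 + \<beta>) * h powr (-2))))"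
    if "0 < T" "0 < n" "0 < h" for T h :: real and n :: nat
  proof -
    \<comment> \<open>Any null sequence in (0, h] would serve; the comparison of widths requires the
      narrower width not to exceed h.\<close>
    define \<delta> where "\<delta> i = h / real (Suc i)" for i
    have \<delta>: "0 < \<delta> i" "\<delta> i \<le> h" for i using that by (auto simp: \<delta>_def field_simps)
    have \<delta>0: "\<delta> \<longlonglongrightarrow> 0" unfolding \<delta>_def[abs_def] by (rule lim_const_over_n[THEN LIMSEQ_Suc])
    let ?u = "\<lambda>i \<omega>. ennreal ((local_time_est X T n h y \<omega> - occupation_avg T (\<delta> i) y \<omega>)\<^sup>2)"
    have [measurable]: "(\<lambda>(\<omega>, s). X (max 0 s) \<omega>) \<in> borel_measurable (M \<Otimes>\<^sub>M borel)"
      by (intro X_jointly_measurable) auto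
    have [measurable]: "occupation_avg T (\<delta> i) y \<in> borel_measurable M" for i
      unfolding occupation_avg_def[abs_def]
      by (intro lborel.borel_measurable_lebesgue_integral; simp add: measurable_cong_sets[OF sets_pair_measure_cong[OF refl sets_lborel] refl]; measurable)
    have [measurable]: "local_time_est X T n h y \<in> borel_measurable M"
      unfolding local_time_est_def[abs_def] by measurable
    have "AE \<omega> in M. continuous_on UNIV (\<lambda>y. L T y \<omega>) \<and> 0 \<le> L T y \<omega> \<and>
        (\<forall>f :: real \<Rightarrow> ennreal. f \<in> borel_measurable borel \<longrightarrow>
           (\<integral>\<^sup>+ s. f (X s \<omega>) * indicator {0..T} s \<partial>lborel) = (\<integral>\<^sup>+ x. f x * ennreal (L T x \<omega>) \<partial>lborel))"
      using assms(4) \<open>0 < T\<close> unfolding is_local_time_def by (auto elim!: AE_mp)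
    \<comment> \<open>The local time enters only here, as an almost sure limit; in the chain below,
      Fatou's lemma carries the uniform bound over to it.\<close>
    then have "AE \<omega> in M. ennreal ((local_time_est X T n h y \<omega> - L T y \<omega>)\<^sup>2) = liminf (\<lambda>i. ?u i \<omega>)"
    proof (rule AE_mp, intro AE_I2 impI)
      fix \<omega> assume \<omega>: "\<omega> \<in> space M"
      assume "continuous_on UNIV (\<lambda>y. L T y \<omega>) \<and> 0 \<le> L T y \<omega> \<and>
        (\<forall>f :: real \<Rightarrow> ennreal. f \<in> borel_measurable borel \<longrightarrow>
           (\<integral>\<^sup>+ s. f (X s \<omega>) * indicator {0..T} s \<partial>lborel) = (\<integral>\<^sup>+ x. f x * ennreal (L T x \<omega>) \<partial>lborel))"
      then have "(\<lambda>i. occupation_avg T (\<delta> i) y \<omega>) \<longlonglongrightarrow> L T y \<omega>"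
        by (intro occupation_avg_tendsto_local_time[OF \<omega> \<open>0 < T\<close>] \<delta>0 \<delta>) auto
      then have "(\<lambda>i. ?u i \<omega>) \<longlonglongrightarrow> ennreal ((local_time_est X T n h y \<omega> - L T y \<omega>)\<^sup>2)"
        by (intro tendsto_ennrealI tendsto_intros)
      then show "ennreal ((local_time_est X T n h y \<omega> - L T y \<omega>)\<^sup>2) = liminf (\<lambda>i. ?u i \<omega>)"
        by (intro lim_imp_Liminf[symmetric]) auto
    qed
    then have "(\<integral>\<^sup>+ \<omega>. ennreal ((local_time_est X T n h y \<omega> - L T y \<omega>)\<^sup>2) \<partial>M) = (\<integral>\<^sup>+ \<omega>. liminf (\<lambda>i. ?u i \<omega>) \<partial>M)"
      by (rule nn_integral_cong_AE)
    also have "\<dots> \<le> liminf (\<lambda>i. \<integral>\<^sup>+ \<omega>. ?u i \<omega> \<partial>M)" by (rule nn_integral_liminf) measurable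
    also have "\<dots> \<le> liminf (\<lambda>i::nat. ennreal (c * (T powr (1 - \<beta>) * (h powr (\<alpha> - 1) + (T / real n) powr (1 + \<beta>) * h powr (-2)))))"
      unfolding c_def using that \<delta>
      by (intro Liminf_mono always_eventually allI second_moment_estimator_occupation_avg) auto
    finally show ?thesis by (simp add: Liminf_const)
  qed
  have le_max: "ennreal (c * (T powr (1 - \<beta>) * Q)) \<le> ennreal c * ennreal (max 1 m * T powr (1 - \<beta>) * Q)"
    if "0 \<le> Q" for T Q m :: real
  proof -
    have "1 * (T powr (1 - \<beta>) * Q) \<le> max 1 m * (T powr (1 - \<beta>) * Q)" using that by (intro mult_right_mono) auto
    then have "c * (T powr (1 - \<beta>) * Q) \<le> c * (max 1 m * T powr (1 - \<beta>) * Q)"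
      using c by (intro mult_left_mono) (auto simp: mult.assoc)
    then have "ennreal (c * (T powr (1 - \<beta>) * Q)) \<le> ennreal (c * (max 1 m * T powr (1 - \<beta>) * Q))" by (rule ennreal_leI)
    also have "\<dots> = ennreal c * ennreal (max 1 m * T powr (1 - \<beta>) * Q)" using c by (rule ennreal_mult')
    finally show ?thesis .
  qed
  show ?thesis
  proof (rule exI[of _ 1], intro conjI allI impI zero_less_one)
    fix \<epsilon> :: real
    \<comment> \<open>At h = \<Delta>^\<beta> both terms of the rate equal \<Delta>^(1-\<beta>),
      which doubles the constant; 2c therefore serves both assertions.\<close>
    let ?C = "ennreal (2 * c)"
    have Cc: "ennreal c \<le> ?C" using c by (intro ennreal_leI) simp
    show "\<exists>C<\<infinity>. C \<ge> 0 \<and>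
             (\<forall>T>0. \<forall>n>0. \<forall>h>0.
                (\<integral>\<^sup>+ \<omega>. ennreal ((local_time_est X T n h y \<omega> - L T y \<omega>)\<^sup>2) \<partial>M)
                  \<le> C * ennreal (max 1 (T powr (-\<epsilon>)) * T powr (1 - 1/\<alpha>)
                       * (h powr (\<alpha> - 1) + (T / real n) powr (1 + 1/\<alpha>) * h powr (-2)))) \<and>
             (\<forall>T>0. \<forall>n>0.
                ennreal ((T / real n) powr (1/\<alpha> - 1)) *
                (\<integral>\<^sup>+ \<omega>. ennreal ((local_time_est X T n ((T / real n) powr (1/\<alpha>)) y \<omega> - L T y \<omega>)\<^sup>2) \<partial>M)
                  \<le> C * ennreal (max 1 (T powr (-\<epsilon>)) * T powr (1 - 1/\<alpha>)))"
    proof (rule exI[of _ ?C], intro conjI allI impI)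
      fix T h :: real and n :: nat assume *: "0 < T" "0 < n" "0 < h"
      let ?Q = "h powr (\<alpha> - 1) + (T / real n) powr (1 + \<beta>) * h powr (-2)"
      have "0 \<le> ?Q" by simp
      from order_trans[OF order_trans[OF main[OF *] le_max[OF this, of T "T powr (-\<epsilon>)"]] mult_right_mono[OF Cc]]
      show "(\<integral>\<^sup>+ \<omega>. ennreal ((local_time_est X T n h y \<omega> - L T y \<omega>)\<^sup>2) \<partial>M)
          \<le> ?C * ennreal (max 1 (T powr (-\<epsilon>)) * T powr (1 - \<beta>) * ?Q)" by simp
    next
      fix T :: real and n :: nat assume *: "0 < T" "0 < n"
      let ?\<Delta> = "T / real n"
      let ?h = "?\<Delta> powr \<beta>"
      have h: "0 < ?h" using * by simp
      have e1: "?h powr (\<alpha> - 1) = ?\<Delta> powr (1 - \<beta>)"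
        unfolding powr_powr using alpha by (intro arg_cong[where f="\<lambda>x. ?\<Delta> powr x"]) (simp add: field_simps)
      have e2: "?\<Delta> powr (1 + \<beta>) * ?h powr (-2) = ?\<Delta> powr (1 - \<beta>)"
        unfolding powr_powr powr_add[symmetric] by (intro arg_cong[where f="\<lambda>x. ?\<Delta> powr x"]) simp
      have e3: "?\<Delta> powr (\<beta> - 1) * ?\<Delta> powr (1 - \<beta>) = 1"
        unfolding powr_add[symmetric] using * by simp
      have "ennreal (?\<Delta> powr (\<beta> - 1)) * (\<integral>\<^sup>+ \<omega>. ennreal ((local_time_est X T n ?h y \<omega> - L T y \<omega>)\<^sup>2) \<partial>M)
          \<le> ennreal (?\<Delta> powr (\<beta> - 1)) * ennreal (c * (T powr (1 - \<beta>) * (?\<Delta> powr (1 - \<beta>) + ?\<Delta> powr (1 - \<beta>))))"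
        using main[OF * h] unfolding e1 e2 by (intro mult_left_mono) auto
      also have "\<dots> = ennreal (?\<Delta> powr (\<beta> - 1) * (c * (T powr (1 - \<beta>) * (?\<Delta> powr (1 - \<beta>) + ?\<Delta> powr (1 - \<beta>)))))"
        by (rule ennreal_mult'[symmetric]) simp
      also have "?\<Delta> powr (\<beta> - 1) * (c * (T powr (1 - \<beta>) * (?\<Delta> powr (1 - \<beta>) + ?\<Delta> powr (1 - \<beta>))))
          = c * (T powr (1 - \<beta>) * (2 * (?\<Delta> powr (\<beta> - 1) * ?\<Delta> powr (1 - \<beta>))))"
        by (simp only: mult_2 distrib_left mult_ac)
      also have "\<dots> = c * (T powr (1 - \<beta>) * 2)" unfolding e3 by simp
      also have "ennreal (c * (T powr (1 - \<beta>) * 2)) \<le> ennreal c * ennreal (max 1 (T powr (-\<epsilon>)) * T powr (1 - \<beta>) * 2)"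
        by (rule le_max) simp
      also have "\<dots> = ?C * ennreal (max 1 (T powr (-\<epsilon>)) * T powr (1 - \<beta>))"
        using c by (subst (1 2) ennreal_mult'[symmetric]) (simp_all add: mult_ac)
      finally show "ennreal (?\<Delta> powr (\<beta> - 1)) * (\<integral>\<^sup>+ \<omega>. ennreal ((local_time_est X T n ?h y \<omega> - L T y \<omega>)\<^sup>2) \<partial>M)
          \<le> ?C * ennreal (max 1 (T powr (-\<epsilon>)) * T powr (1 - \<beta>))" .
    qed auto
  qed
qed

end
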